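(* Let $A$ be a finite dimensional CW-complex, $A\neq *$, and let $X$ be a $CW(A)$-complex. Let $\mathcal{K}$ and $\mathcal{K}'$ be $CW(A)$-structures on $X$ and let $n,m\in\mathbb{N}_0\cup\{\infty\}$ denote their respective dimensions. Then $n=m$.
   Context: All spaces and maps are pointed. $\mathrm{C}X$ is the reduced cone, $\Sigma X$ the reduced suspension, $\Sigma^0A=A$. For $n\ge 1$, $X$ is obtained from a pointed space $Z$ by attaching $n$-cells of type $A$ if $X$ is a pushout of $Z\xleftarrow{\,g\,}\bigvee_{\alpha\in J}\Sigma^{n-1}A\xrightarrow{\,i\,}\bigvee_{\alpha\in J}\mathrm{C}\Sigma^{n-1}A$ for some index set $J$ and some map $g$, where $i$ is the wedge of the inclusions as bases of the cones. $X$ is obtained from $Z$ by attaching $0$-cells of type $A$ if $X=Z\vee\bigvee_{\alpha\in J}A$. A $CW(A)$-structure on $X$ is a sequence $*=X^{-1}\to X^0\to X^1\to\cdots$ with colimit $X$ such that, for all $n\ge 0$, $X^n$ is obtained from $X^{n-1}$ by attaching $n$-cells of type $A$; a space admitting one is a $CW(A)$-complex. The dimension of a $CW(A)$-structure is $n\in\mathbb{N}_0$ if $X^n=X$ and $X^{n-1}\neq X$; the structure is then called finite dimensional. Dimension $\infty$ means that the structure is not finite dimensional. *)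

theory Defs
  imports "HOL-Analysis.Analysis" "HOL-Library.Extended_Nat" "HOL-Library.Disjoint_Sets"
begin

section \<open>Pointed spaces\<close>

record 'a pointed =
  topo :: "'a topology"
  pt :: 'a

definition pointed_space :: "'a pointed \<Rightarrow> bool" where
  "pointed_space X \<longleftrightarrow> pt X \<in> topspace (topo X)"

definition pointed_map :: "'a pointed \<Rightarrow> 'b pointed \<Rightarrow> ('a \<Rightarrow> 'b) \<Rightarrow> bool" where
  "pointed_map X Y f \<longleftrightarrow> continuous_map (topo X) (topo Y) f \<and> f (pt X) = pt Y"

definition one_point :: "unit pointed" where
  "one_point = \<lparr>topo = discrete_topology {()}, pt = ()\<rparr>"


section \<open>Quotients\<close>

text \<open>\<open>q\<close> exhibits \<open>P\<close> as the quotient of \<open>X\<close> by the equivalence relation generated by \<open>r\<close>.\<close>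

definition is_quotient_by ::
  "'a topology \<Rightarrow> ('a \<Rightarrow> 'a \<Rightarrow> bool) \<Rightarrow> 'b topology \<Rightarrow> ('a \<Rightarrow> 'b) \<Rightarrow> bool" where
  "is_quotient_by X r P q \<longleftrightarrow>
     quotient_map X P q \<and>
     (\<forall>x\<in>topspace X. \<forall>y\<in>topspace X. q x = q y \<longleftrightarrow> equivclp r x y)"

lemma is_quotient_by_lift:
  assumes q: "is_quotient_by X r P q" and h: "continuous_map X T h"
    and r: "\<And>x y. r x y \<Longrightarrow> h x = h y"
  obtains k where "continuous_map P T k" "\<And>x. x \<in> topspace X \<Longrightarrow> k (q x) = h x"
proof -
  have eq: "h x = h y" if "equivclp r x y" for x y
    using that by (induction rule: equivclp_induct) (auto dest: r)
  have "quotient_map X P q" using q by (simp add: is_quotient_by_def)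
  then show thesis
    by (rule quotient_map_lift_exists[OF _ h]) (use q eq that in \<open>auto simp: is_quotient_by_def\<close>)
qed

text \<open>The quotient \<open>X/S\<close>. The point \<open>None\<close> is the class of \<open>S\<close>; if \<open>S\<close> is empty, it is an added
  isolated point, so that an empty wedge (below) is a one-point space.\<close>

definition collapse_proj :: "'a set \<Rightarrow> 'a \<Rightarrow> 'a option" where
  "collapse_proj S x = (if x \<in> S then None else Some x)"

definition collapse :: "'a topology \<Rightarrow> 'a set \<Rightarrow> 'a option pointed" where
  "collapse X S =
     \<lparr>topo = topology (\<lambda>U. U \<subseteq> insert None (Some ` (topspace X - S)) \<and>
                           openin X {x \<in> topspace X. collapse_proj S x \<in> U}),
      pt = None\<rparr>"

lemma istopology_preimage:
  "istopology (\<lambda>U. U \<subseteq> C \<and> openin X {x \<in> topspace X. f x \<in> U})"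
proof -
  have 1: "{x \<in> topspace X. f x \<in> U \<inter> V} =
           {x \<in> topspace X. f x \<in> U} \<inter> {x \<in> topspace X. f x \<in> V}" for U V
    by auto
  have 2: "{x \<in> topspace X. f x \<in> \<Union>\<K>} = (\<Union>K\<in>\<K>. {x \<in> topspace X. f x \<in> K})" for \<K>
    by auto
  show ?thesis
    unfolding istopology_def 1 2 by blast
qed

lemma openin_collapse:
  "openin (topo (collapse X S)) U \<longleftrightarrow>
     U \<subseteq> insert None (Some ` (topspace X - S)) \<and>
     openin X {x \<in> topspace X. collapse_proj S x \<in> U}"
  by (simp add: collapse_def istopology_preimage)

lemma topspace_collapse: "topspace (topo (collapse X S)) = insert None (Some ` (topspace X - S))"
proof -
  have *: "{x \<in> topspace X. collapse_proj S x \<in> insert None (Some ` (topspace X - S))} = topspace X"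
    by (auto simp: collapse_proj_def)
  have "openin (topo (collapse X S)) (insert None (Some ` (topspace X - S)))"
    unfolding openin_collapse * by simp
  moreover have "topspace (topo (collapse X S)) \<subseteq> insert None (Some ` (topspace X - S))"
    using openin_topspace[of "topo (collapse X S)"] unfolding openin_collapse by (rule conjunct1)
  ultimately show ?thesis
    by (intro subset_antisym openin_subset)
qed

lemma quotient_map_collapse:
  assumes "S \<subseteq> topspace X" "S \<noteq> {}"
  shows "quotient_map X (topo (collapse X S)) (collapse_proj S)"
  using assms unfolding quotient_map_def topspace_collapse openin_collapse
  by (auto simp: collapse_proj_def image_iff split: if_splits)

text \<open>The space \<open>X\<close> transported along an injective relabelling \<open>f\<close> of its points.\<close>

definition relabel :: "('a \<Rightarrow> 'b) \<Rightarrow> 'a pointed \<Rightarrow> 'b pointed" where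
  "relabel f X =
     \<lparr>topo = topology (\<lambda>U. U \<subseteq> f ` topspace (topo X) \<and>
                           openin (topo X) {x \<in> topspace (topo X). f x \<in> U}),
      pt = f (pt X)\<rparr>"

lemma openin_relabel:
  "openin (topo (relabel f X)) U \<longleftrightarrow>
     U \<subseteq> f ` topspace (topo X) \<and> openin (topo X) {x \<in> topspace (topo X). f x \<in> U}"
  by (simp add: relabel_def istopology_preimage)

lemma topspace_relabel: "topspace (topo (relabel f X)) = f ` topspace (topo X)"
proof -
  have "{x \<in> topspace (topo X). f x \<in> f ` topspace (topo X)} = topspace (topo X)"
    by auto
  then have "openin (topo (relabel f X)) (f ` topspace (topo X))"
    unfolding openin_relabel by simp
  moreover have "topspace (topo (relabel f X)) \<subseteq> f ` topspace (topo X)"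
    using openin_topspace[of "topo (relabel f X)"] unfolding openin_relabel by (rule conjunct1)
  ultimately show ?thesis
    by (intro subset_antisym openin_subset)
qed

lemma homeomorphic_map_relabel:
  assumes "inj f"
  shows "homeomorphic_map (topo X) (topo (relabel f X)) f"
proof -
  have "quotient_map (topo X) (topo (relabel f X)) f"
    unfolding quotient_map_def topspace_relabel openin_relabel by simp
  moreover have "inj_on f (topspace (topo X))"
    using assms inj_on_subset by blast
  ultimately show ?thesis
    by (simp add: homeomorphic_map_def)
qed


section \<open>Wedges, reduced cones and reduced suspensions\<close>

definition wedge :: "'j set \<Rightarrow> ('j \<Rightarrow> 'a pointed) \<Rightarrow> ('j \<times> 'a) option pointed" where
  "wedge J X = collapse (sum_topology (\<lambda>j. topo (X j)) J) {(j, pt (X j)) |j. j \<in> J}"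

definition wedge_map ::
  "'j set \<Rightarrow> ('j \<Rightarrow> 'b pointed) \<Rightarrow> ('j \<Rightarrow> 'a \<Rightarrow> 'b) \<Rightarrow> ('j \<times> 'a) option \<Rightarrow> ('j \<times> 'b) option" where
  "wedge_map J Y f w =
     (case w of None \<Rightarrow> None
      | Some (j, x) \<Rightarrow> collapse_proj {(j, pt (Y j)) |j. j \<in> J} (j, f j x))"

abbreviation cylinder :: "'a pointed \<Rightarrow> ('a \<times> real) topology" where
  "cylinder X \<equiv> prod_topology (topo X) (top_of_set {0..1})"

definition cone_collapsed :: "'a pointed \<Rightarrow> ('a \<times> real) set" where
  "cone_collapsed X = topspace (topo X) \<times> {1} \<union> {pt X} \<times> {0..1}"

definition reduced_cone :: "'a pointed \<Rightarrow> ('a \<times> real) option pointed" where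
  "reduced_cone X = collapse (cylinder X) (cone_collapsed X)"

definition cone_base :: "'a pointed \<Rightarrow> 'a \<Rightarrow> ('a \<times> real) option" where
  "cone_base X x = collapse_proj (cone_collapsed X) (x, 0)"

definition reduced_suspension :: "'a pointed \<Rightarrow> ('a \<times> real) option pointed" where
  "reduced_suspension X =
     collapse (cylinder X) (topspace (topo X) \<times> {0, 1} \<union> {pt X} \<times> {0..1})"

text \<open>One suspension changes the type of the points. The following type contains the points of all
  the iterated suspensions of a space with points in \<open>'a\<close>.\<close>

datatype 'a susp_pt = Orig 'a | Susp "('a susp_pt \<times> real) option"

primrec iter_suspension :: "nat \<Rightarrow> 'a pointed \<Rightarrow> 'a susp_pt pointed" where
  "iter_suspension 0 A = relabel Orig A"
| "iter_suspension (Suc n) A = relabel Susp (reduced_suspension (iter_suspension n A))"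


section \<open>Pushouts and sequential colimits\<close>

definition sum2_topology :: "'a topology \<Rightarrow> 'b topology \<Rightarrow> ('a + 'b) topology" where
  "sum2_topology X Y = topology (\<lambda>U. openin X (Inl -` U) \<and> openin Y (Inr -` U))"

lemma openin_sum2_topology:
  "openin (sum2_topology X Y) U \<longleftrightarrow> openin X (Inl -` U) \<and> openin Y (Inr -` U)"
proof -
  have "istopology (\<lambda>U. openin X (Inl -` U) \<and> openin Y (Inr -` U))"
    unfolding istopology_def vimage_Int vimage_Union by auto
  then show ?thesis
    by (simp add: sum2_topology_def)
qed

lemma topspace_sum2_topology: "topspace (sum2_topology X Y) = topspace X <+> topspace Y"
proof -
  have *: "Inl -` (topspace X <+> topspace Y) = topspace X"
          "Inr -` (topspace X <+> topspace Y) = topspace Y"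
    by auto
  have "openin (sum2_topology X Y) (topspace X <+> topspace Y)"
    unfolding openin_sum2_topology * by simp
  moreover have "U \<subseteq> topspace X <+> topspace Y" if "openin (sum2_topology X Y) U" for U
  proof
    fix u assume "u \<in> U"
    with that show "u \<in> topspace X <+> topspace Y"
      by (cases u) (auto simp: openin_sum2_topology dest: openin_subset)
  qed
  ultimately show ?thesis
    by (meson openin_subset openin_topspace subset_antisym)
qed

lemma continuous_map_case_sum:
  assumes "continuous_map X T u" "continuous_map Y T v"
  shows "continuous_map (sum2_topology X Y) T (case_sum u v)"
proof -
  have "Inl -` {x \<in> topspace X <+> topspace Y. case_sum u v x \<in> U} = {x \<in> topspace X. u x \<in> U}"
       "Inr -` {x \<in> topspace X <+> topspace Y. case_sum u v x \<in> U} = {x \<in> topspace Y. v x \<in> U}" for U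
    by auto
  then show ?thesis
    using assms
    unfolding continuous_map_def openin_sum2_topology topspace_sum2_topology
    by auto
qed

text \<open>The square with sides \<open>g : S \<rightarrow> Z\<close>, \<open>i : S \<rightarrow> W\<close>, \<open>p : Z \<rightarrow> P\<close>, \<open>q : W \<rightarrow> P\<close> is a pushout of
  pointed spaces.\<close>

definition is_pushout ::
  "'s pointed \<Rightarrow> ('s \<Rightarrow> 'z) \<Rightarrow> ('s \<Rightarrow> 'w) \<Rightarrow> 'z pointed \<Rightarrow> 'w pointed \<Rightarrow>
   'p pointed \<Rightarrow> ('z \<Rightarrow> 'p) \<Rightarrow> ('w \<Rightarrow> 'p) \<Rightarrow> bool" where
  "is_pushout S g i Z W P p q \<longleftrightarrow>
     pointed_map S Z g \<and> pointed_map S W i \<and> pointed_map Z P p \<and> pointed_map W P q \<and>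
     is_quotient_by (sum2_topology (topo Z) (topo W))
       (\<lambda>u v. \<exists>s\<in>topspace (topo S). u = Inl (g s) \<and> v = Inr (i s))
       (topo P) (case_sum p q)"

lemma is_pushout_commutes:
  assumes "is_pushout S g i Z W P p q" "s \<in> topspace (topo S)"
  shows "p (g s) = q (i s)"
proof -
  let ?r = "\<lambda>u v. \<exists>s\<in>topspace (topo S). u = Inl (g s) \<and> v = Inr (i s)"
  have "equivclp ?r (Inl (g s)) (Inr (i s))"
    using assms(2) by blast
  moreover have "g s \<in> topspace (topo Z)" "i s \<in> topspace (topo W)"
    using assms by (auto simp: is_pushout_def pointed_map_def continuous_map_def)
  then have "Inl (g s) \<in> topspace (sum2_topology (topo Z) (topo W))"
            "Inr (i s) \<in> topspace (sum2_topology (topo Z) (topo W))"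
    by (auto simp: topspace_sum2_topology)
  ultimately have "case_sum p q (Inl (g s)) = case_sum p q (Inr (i s))"
    using assms(1) unfolding is_pushout_def is_quotient_by_def by blast
  then show ?thesis by simp
qed

lemma is_pushout_universal:
  assumes P: "is_pushout S g i Z W P p q" and Z: "pointed_space Z"
    and u: "pointed_map Z T u" and v: "pointed_map W T v"
    and uv: "\<And>s. s \<in> topspace (topo S) \<Longrightarrow> u (g s) = v (i s)"
  shows "\<exists>h. pointed_map P T h \<and> (\<forall>z\<in>topspace (topo Z). h (p z) = u z) \<and>
             (\<forall>w\<in>topspace (topo W). h (q w) = v w)"
    and "\<lbrakk>\<forall>z\<in>topspace (topo Z). h (p z) = h' (p z); \<forall>w\<in>topspace (topo W). h (q w) = h' (q w);
          y \<in> topspace (topo P)\<rbrakk> \<Longrightarrow> h y = h' y"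
proof -
  let ?Q = "sum2_topology (topo Z) (topo W)"
  let ?r = "\<lambda>a b. \<exists>s\<in>topspace (topo S). a = Inl (g s) \<and> b = Inr (i s)"
  have q: "is_quotient_by ?Q ?r (topo P) (case_sum p q)"
    using P by (simp add: is_pushout_def)
  have "continuous_map ?Q (topo T) (case_sum u v)"
    using u v by (intro continuous_map_case_sum) (auto simp: pointed_map_def)
  then obtain h where h: "continuous_map (topo P) (topo T) h"
      "\<And>x. x \<in> topspace ?Q \<Longrightarrow> h (case_sum p q x) = case_sum u v x"
    by (rule is_quotient_by_lift[OF q]) (auto simp: uv)
  have hz: "h (p z) = u z" if "z \<in> topspace (topo Z)" for z
    using h(2)[of "Inl z"] that by (auto simp: topspace_sum2_topology)
  have hw: "h (q w) = v w" if "w \<in> topspace (topo W)" for w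
    using h(2)[of "Inr w"] that by (auto simp: topspace_sum2_topology)
  have "p (pt Z) = pt P" "u (pt Z) = pt T"
    using P u by (auto simp: is_pushout_def pointed_map_def)
  with hz[of "pt Z"] Z have "h (pt P) = pt T"
    by (simp add: pointed_space_def)
  with h(1) hz hw show "\<exists>h. pointed_map P T h \<and> (\<forall>z\<in>topspace (topo Z). h (p z) = u z) \<and>
             (\<forall>w\<in>topspace (topo W). h (q w) = v w)"
    unfolding pointed_map_def by blast
next
  assume *: "\<forall>z\<in>topspace (topo Z). h (p z) = h' (p z)" "\<forall>w\<in>topspace (topo W). h (q w) = h' (q w)"
    and y: "y \<in> topspace (topo P)"
  have "case_sum p q ` topspace (sum2_topology (topo Z) (topo W)) = topspace (topo P)"
    using P by (simp add: is_pushout_def is_quotient_by_def quotient_map_def)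
  with y have "y \<in> case_sum p q ` (topspace (topo Z) <+> topspace (topo W))"
    by (simp add: topspace_sum2_topology)
  then show "h y = h' y"
    using * by auto
qed

text \<open>The maps \<open>c k : X k \<rightarrow> L\<close> exhibit \<open>L\<close> as the colimit of the sequence with bonding maps
  \<open>b k : X k \<rightarrow> X (k + 1)\<close>.\<close>

definition is_sequential_colimit ::
  "(nat \<Rightarrow> 'k pointed) \<Rightarrow> (nat \<Rightarrow> 'k \<Rightarrow> 'k) \<Rightarrow> 'x pointed \<Rightarrow> (nat \<Rightarrow> 'k \<Rightarrow> 'x) \<Rightarrow> bool" where
  "is_sequential_colimit X b L c \<longleftrightarrow>
     (\<forall>k. pointed_map (X k) (X (Suc k)) (b k)) \<and>
     (\<forall>k. pointed_map (X k) L (c k)) \<and>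
     is_quotient_by (sum_topology (\<lambda>k. topo (X k)) UNIV)
       (\<lambda>u v. \<exists>k. \<exists>x\<in>topspace (topo (X k)). u = (k, x) \<and> v = (Suc k, b k x))
       (topo L) (\<lambda>(k, x). c k x)"


section \<open>Finite dimensional CW-complexes\<close>

definition disc :: "nat \<Rightarrow> (nat \<Rightarrow> real) topology" where
  "disc k = subtopology (Euclidean_space k) {x. (\<Sum>i<k. (x i)\<^sup>2) \<le> 1}"

definition disc_interior :: "nat \<Rightarrow> (nat \<Rightarrow> real) set" where
  "disc_interior k = {x \<in> topspace (disc k). (\<Sum>i<k. (x i)\<^sup>2) < 1}"

definition disc_boundary :: "nat \<Rightarrow> (nat \<Rightarrow> real) set" where
  "disc_boundary k = {x \<in> topspace (disc k). (\<Sum>i<k. (x i)\<^sup>2) = 1}"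

text \<open>Whitehead's definition: \<open>E\<close> is the set of open cells, and the cell \<open>e\<close> has dimension \<open>d e\<close>
  and characteristic map \<open>\<Phi> e\<close>. The last two conditions are closure-finiteness and the weak
  topology.\<close>

definition CW_structure ::
  "'a topology \<Rightarrow> 'a set set \<Rightarrow> ('a set \<Rightarrow> nat) \<Rightarrow> ('a set \<Rightarrow> (nat \<Rightarrow> real) \<Rightarrow> 'a) \<Rightarrow> bool" where
  "CW_structure X E d \<Phi> \<longleftrightarrow>
     Hausdorff_space X \<and>
     partition_on (topspace X) E \<and>
     (\<forall>e\<in>E. continuous_map (disc (d e)) X (\<Phi> e) \<and>
             homeomorphic_map (subtopology (disc (d e)) (disc_interior (d e)))
                              (subtopology X e) (\<Phi> e)) \<and>
     (\<forall>e\<in>E. \<exists>F. finite F \<and> F \<subseteq> {e' \<in> E. d e' < d e} \<and> \<Phi> e ` disc_boundary (d e) \<subseteq> \<Union>F) \<and>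
     (\<forall>C\<subseteq>topspace X. (\<forall>e\<in>E. closedin X (C \<inter> X closure_of e)) \<longrightarrow> closedin X C)"

definition finite_dimensional_CW_complex :: "'a topology \<Rightarrow> bool" where
  "finite_dimensional_CW_complex X \<longleftrightarrow>
     (\<exists>E d \<Phi> N. CW_structure X E d \<Phi> \<and> (\<forall>e\<in>E. d e \<le> N))"


section \<open>CW(A)-structures\<close>

text \<open>\<open>X\<close> is obtained from \<open>Z\<close> by attaching \<open>n\<close>-cells of type \<open>A\<close> indexed by \<open>J\<close>, where
  \<open>j : Z \<rightarrow> X\<close> is the canonical map. For \<open>n = 0\<close>, the pushout over a point is the wedge
  of \<open>Z\<close> and \<open>\<Or>\<^sub>J A\<close>.\<close>

definition attaches_cells ::
  "'a pointed \<Rightarrow> nat \<Rightarrow> 'j set \<Rightarrow> 'z pointed \<Rightarrow> ('z \<Rightarrow> 'x) \<Rightarrow> 'x pointed \<Rightarrow> bool" where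
  "attaches_cells A n J Z j X \<longleftrightarrow>
     (case n of
        0 \<Rightarrow>
          (\<exists>f. is_pushout one_point (\<lambda>_. pt Z) (\<lambda>_. pt (wedge J (\<lambda>_. A)))
                 Z (wedge J (\<lambda>_. A)) X j f)
      | Suc m \<Rightarrow>
          (let S = iter_suspension m A in
           \<exists>g f. is_pushout (wedge J (\<lambda>_. S)) g
                   (wedge_map J (\<lambda>_. reduced_cone S) (\<lambda>_. cone_base S))
                   Z (wedge J (\<lambda>_. reduced_cone S)) X j f))"

text \<open>The indexing is shifted by one: \<open>stage K n\<close> is \<open>X\<^sup>n\<^sup>-\<^sup>1\<close>, so \<open>stage K 0\<close> is \<open>X\<^sup>-\<^sup>1\<close>, and
  \<open>cells K n\<close> indexes the \<open>n\<close>-cells attached to \<open>stage K n\<close> to obtain \<open>stage K (Suc n)\<close>.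
  All stages have their points in one type \<open>'k\<close>; this is no restriction, as they embed in their
  colimit.\<close>

record ('j, 'k, 'x) CWA_structure =
  stage :: "nat \<Rightarrow> 'k pointed"
  bond :: "nat \<Rightarrow> 'k \<Rightarrow> 'k"
  incl :: "nat \<Rightarrow> 'k \<Rightarrow> 'x"
  cells :: "nat \<Rightarrow> 'j set"

definition is_CWA_structure ::
  "'a pointed \<Rightarrow> 'x pointed \<Rightarrow> ('j, 'k, 'x) CWA_structure \<Rightarrow> bool" where
  "is_CWA_structure A X K \<longleftrightarrow>
     pointed_space X \<and>
     (\<forall>n. pointed_space (stage K n)) \<and>
     topspace (topo (stage K 0)) = {pt (stage K 0)} \<and>
     is_sequential_colimit (stage K) (bond K) X (incl K) \<and>
     (\<forall>n. attaches_cells A n (cells K n) (stage K n) (bond K n) (stage K (Suc n)))"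

text \<open>\<open>X\<^sup>n\<^sup>-\<^sup>1 = X\<close>, that is, the canonical map from \<open>X\<^sup>n\<^sup>-\<^sup>1\<close> to \<open>X\<close> is a homeomorphism.\<close>

definition stage_is_all :: "'x pointed \<Rightarrow> ('j, 'k, 'x) CWA_structure \<Rightarrow> nat \<Rightarrow> bool" where
  "stage_is_all X K n \<longleftrightarrow> homeomorphic_map (topo (stage K n)) (topo X) (incl K n)"

definition has_finite_dimension :: "'x pointed \<Rightarrow> ('j, 'k, 'x) CWA_structure \<Rightarrow> nat \<Rightarrow> bool" where
  "has_finite_dimension X K n \<longleftrightarrow> stage_is_all X K (Suc n) \<and> \<not> stage_is_all X K n"

definition has_dimension :: "'x pointed \<Rightarrow> ('j, 'k, 'x) CWA_structure \<Rightarrow> enat \<Rightarrow> bool" where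
  "has_dimension X K d \<longleftrightarrow>
     (case d of enat n \<Rightarrow> has_finite_dimension X K n
      | \<infinity> \<Rightarrow> \<not> (\<exists>n. has_finite_dimension X K n))"

end

(* A d-dimensional complex A has two topological features that survive the construction: no open
   subset of a Euclidean space of dimension greater than d injects continuously into A, while an open
   subset of R^d injects continuously into A minus its base point. Each suspension and the final cone
   raise both bounds by one, and the complement of Z in a space obtained from Z by attaching n-cells
   of type A is a disjoint union of punctured n-cells of type A. So the maximal dimension of a
   Euclidean open set that injects continuously into X is d + n whenever X has an n-dimensional
   structure, and there is no such maximum if X has cells in arbitrarily high dimensions; it does not
   depend on the structure. The base point of A need not be a 0-cell and the attaching maps
   need not be cellular; all that is used is invariance of domain and that attaching cells and
   passing to the colimit give closed embeddings. *)

theory Submission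
  imports Defs "HOL-Homology.Invariance_of_Domain"
begin

text \<open>Homology cannot detect the dimension: if \<open>A\<close> is an interval, say, then
  \<open>A\<close> and its wedges are contractible. A topological dimension would need a theory for
  spaces that are neither metrizable nor known to be Hausdorff. Continuous injections from open sets
  of R^N (plots) need no separation axioms: they compose with continuous injections, and any
  nonempty open piece of the domain is as good as the whole. The price is the upper bound for a
  product with an interval: a plot of the product need not project to a plot of a factor. The
  auxiliary map into R^k repairs this, because the interval coordinate can be moved into it. Lower
  bounds have to be attained off the base point because cone and suspension collapse the segment
  over it. No upper bound for a general colimit is required: if one structure is finite,
  \<open>X\<close> is one of its stages, and cells of the other structure supply lower bounds
  only.\<close>

section \<open>Dimension by Euclidean plots\<close>

text \<open>The factor \<open>Euclidean_space k\<close> makes the bound stable under products with intervals.\<close>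

definition edim_le :: "'a topology \<Rightarrow> nat \<Rightarrow> bool" where
  "edim_le X c \<longleftrightarrow>
     (\<forall>N k U f g. openin (Euclidean_space N) U \<longrightarrow> U \<noteq> {} \<longrightarrow>
        continuous_map (subtopology (Euclidean_space N) U) X f \<longrightarrow>
        continuous_map (subtopology (Euclidean_space N) U) (Euclidean_space k) g \<longrightarrow>
        inj_on (\<lambda>u. (f u, g u)) U \<longrightarrow> N \<le> c + k)"

text \<open>A lower bound needs only one plot, and a product with an interval is served by adding a
  coordinate to its domain; hence no auxiliary map here.\<close>

definition edim_ge :: "'a topology \<Rightarrow> nat \<Rightarrow> bool" where
  "edim_ge X N \<longleftrightarrow>
     (\<exists>U f. openin (Euclidean_space N) U \<and> U \<noteq> {} \<and>
        continuous_map (subtopology (Euclidean_space N) U) X f \<and> inj_on f U)"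

lemma topspace_subtopology_openin:
  "openin X U \<Longrightarrow> topspace (subtopology X U) = U"
  using openin_subset by (metis topspace_subtopology_subset)

lemma continuous_map_openin_in_topspace:
  "\<lbrakk>openin E U; continuous_map (subtopology E U) X f; u \<in> U\<rbrakk> \<Longrightarrow> f u \<in> topspace X"
  using continuous_map_image_subset_topspace topspace_subtopology_openin by blast

lemma edim_leD:
  "\<lbrakk>edim_le X c; openin (Euclidean_space N) U; U \<noteq> {};
    continuous_map (subtopology (Euclidean_space N) U) X f;
    continuous_map (subtopology (Euclidean_space N) U) (Euclidean_space k) g;
    inj_on (\<lambda>u. (f u, g u)) U\<rbrakk> \<Longrightarrow> N \<le> c + k"
  unfolding edim_le_def by blast

lemma edim_le_mono: "edim_le X c \<Longrightarrow> c \<le> c' \<Longrightarrow> edim_le X c'"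
  unfolding edim_le_def by (meson add_le_mono1 order_trans)

text \<open>This is the case k = 0 of the upper bound, with the one-point space R^0 as target of the
  auxiliary map.\<close>

lemma edim_ge_imp_le:
  assumes "edim_ge X N" "edim_le X c"
  shows "N \<le> c"
proof -
  obtain U f where U: "openin (Euclidean_space N) U" "U \<noteq> {}"
      "continuous_map (subtopology (Euclidean_space N) U) X f" "inj_on f U"
    using assms(1) by (auto simp: edim_ge_def)
  have "continuous_map (subtopology (Euclidean_space N) U) (Euclidean_space 0) (\<lambda>u i. 0)"
    by (simp add: topspace_Euclidean_space)
  then have "N \<le> c + 0"
    by (rule edim_leD[OF assms(2) U(1-3)]) (use U(4) in \<open>auto simp: inj_on_def\<close>)
  then show ?thesis by simp
qed

lemma edim_ge_inj:
  assumes "edim_ge X N" "continuous_map X Y h" "inj_on h (topspace X)"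
  shows "edim_ge Y N"
proof -
  obtain U f where U: "openin (Euclidean_space N) U" "U \<noteq> {}"
      "continuous_map (subtopology (Euclidean_space N) U) X f" "inj_on f U"
    using assms(1) by (auto simp: edim_ge_def)
  have "f ` U \<subseteq> topspace X"
    using continuous_map_openin_in_topspace[OF U(1,3)] by blast
  then have "inj_on (h \<circ> f) U"
    using U(4) assms(3) by (meson comp_inj_on inj_on_subset)
  then show ?thesis
    using U continuous_map_compose[OF U(3) assms(2)] unfolding edim_ge_def by blast
qed

lemma edim_le_inj:
  assumes "edim_le Y c" and h: "continuous_map X Y h" "inj_on h (topspace X)"
  shows "edim_le X c"
  unfolding edim_le_def
proof (intro allI impI)
  fix N k U f g
  assume U: "openin (Euclidean_space N) U" "U \<noteq> {}"
    and f: "continuous_map (subtopology (Euclidean_space N) U) X f"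
    and g: "continuous_map (subtopology (Euclidean_space N) U) (Euclidean_space k) g"
    and i: "inj_on (\<lambda>u. (f u, g u)) U"
  have "f u \<in> topspace X" if "u \<in> U" for u
    using continuous_map_openin_in_topspace[OF U(1) f] that .
  then have "inj_on (\<lambda>u. ((h \<circ> f) u, g u)) U"
    using i h(2) by (auto simp: inj_on_def)
  then show "N \<le> c + k"
    by (rule edim_leD[OF assms(1) U continuous_map_compose[OF f h(1)] g])
qed

text \<open>The real coordinate is transferred from the plot to the auxiliary map, which then lands
  in R^(k+1). Only \<open>h\<close> and \<open>t\<close> together have to separate points;
  \<open>h\<close> alone may collapse, like the projection of a cylinder.\<close>

lemma edim_le_times_real:
  assumes "edim_le Y c" and h: "continuous_map X Y h" and t: "continuous_map X euclideanreal t"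
    and ht: "inj_on (\<lambda>x. (h x, t x)) (topspace X)"
  shows "edim_le X (Suc c)"
  unfolding edim_le_def
proof (intro allI impI)
  fix N k U f g
  assume U: "openin (Euclidean_space N) U" "U \<noteq> {}"
    and f: "continuous_map (subtopology (Euclidean_space N) U) X f"
    and g: "continuous_map (subtopology (Euclidean_space N) U) (Euclidean_space k) g"
    and i: "inj_on (\<lambda>u. (f u, g u)) U"
  have fX: "f u \<in> topspace X" and gk: "g u \<in> topspace (Euclidean_space k)" if "u \<in> U" for u
    using continuous_map_openin_in_topspace[OF U(1) f] continuous_map_openin_in_topspace[OF U(1) g]
      that by auto
  let ?g = "\<lambda>u i. if i < Suc k then (if i = k then t (f u) else g u i) else 0"
  have comp: "continuous_map (subtopology (Euclidean_space N) U) euclideanreal (\<lambda>u. g u i)" for i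
    using g unfolding Euclidean_space_def continuous_map_in_subtopology
    by (auto simp: continuous_map_componentwise_UNIV)
  have "continuous_map (subtopology (Euclidean_space N) U) (Euclidean_space (Suc k)) ?g"
    unfolding continuous_map_componentwise_Euclidean_space
    using comp continuous_map_compose[OF f t] by (auto simp: o_def)
  moreover have "inj_on (\<lambda>u. ((h \<circ> f) u, ?g u)) U"
  proof (rule inj_onI)
    fix u v assume uv: "u \<in> U" "v \<in> U" "((h \<circ> f) u, ?g u) = ((h \<circ> f) v, ?g v)"
    from uv(3) have "?g u = ?g v"
      by (rule Pair_inject)
    from fun_cong[OF this] have eq: "?g u i = ?g v i" for i .
    have "t (f u) = t (f v)"
      using eq[of k] by simp
    then have "f u = f v"
      using uv ht fX by (auto simp: inj_on_def)
    moreover have "g u = g v"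
    proof
      fix i show "g u i = g v i"
        using eq[of i] gk uv(1,2) by (cases "i < k") (auto simp: topspace_Euclidean_space)
    qed
    ultimately show "u = v"
      using i uv by (auto simp: inj_on_def)
  qed
  ultimately have "N \<le> c + Suc k"
    by (intro edim_leD[OF assms(1) U continuous_map_compose[OF f h]])
  then show "N \<le> Suc c + k" by simp
qed

text \<open>The bound concerns only the dimension of the domain, so a plot may be shrunk to a
  nonempty open part of its domain. \<open>T\<close> may depend on the plot and need not be open in
  \<open>X\<close>; only its preimage is open.\<close>

lemma edim_leI_restrict:
  assumes "\<And>N U f. \<lbrakk>openin (Euclidean_space N) U; U \<noteq> {};
       continuous_map (subtopology (Euclidean_space N) U) X f\<rbrakk> \<Longrightarrow>
     \<exists>T. openin (Euclidean_space N) {u \<in> U. f u \<in> T} \<and> {u \<in> U. f u \<in> T} \<noteq> {} \<and>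
         edim_le (subtopology X T) c"
  shows "edim_le X c"
  unfolding edim_le_def
proof (intro allI impI)
  fix N k U f g
  assume U: "openin (Euclidean_space N) U" "U \<noteq> {}"
    and f: "continuous_map (subtopology (Euclidean_space N) U) X f"
    and g: "continuous_map (subtopology (Euclidean_space N) U) (Euclidean_space k) g"
    and i: "inj_on (\<lambda>u. (f u, g u)) U"
  from assms[OF U f] obtain T where T: "openin (Euclidean_space N) {u \<in> U. f u \<in> T}"
      "{u \<in> U. f u \<in> T} \<noteq> {}" "edim_le (subtopology X T) c"
    by blast
  let ?V = "{u \<in> U. f u \<in> T}"
  have "continuous_map (subtopology (Euclidean_space N) ?V) (subtopology X T) f"
    using continuous_map_from_subtopology_mono[OF f, of ?V]
    by (auto simp: continuous_map_in_subtopology)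
  moreover have "continuous_map (subtopology (Euclidean_space N) ?V) (Euclidean_space k) g"
    using continuous_map_from_subtopology_mono[OF g, of ?V] by auto
  moreover have "inj_on (\<lambda>u. (f u, g u)) ?V"
    using i by (rule inj_on_subset) auto
  ultimately show "N \<le> c + k"
    by (rule edim_leD[OF T(3,1,2)])
qed

lemma openin_preimage_subtopology:
  assumes "openin E U" "continuous_map (subtopology E U) X f" "openin X T"
  shows "openin E {u \<in> U. f u \<in> T}"
proof -
  have "openin (subtopology E U) {u \<in> U. f u \<in> T}"
    using openin_continuous_map_preimage[OF assms(2,3)]
    unfolding topspace_subtopology_openin[OF assms(1)] .
  then show ?thesis
    using assms(1) openin_trans_full by blast
qed

lemma edim_le_open_cover:
  assumes "\<And>x. x \<in> topspace X \<Longrightarrow> \<exists>T. openin X T \<and> x \<in> T \<and> edim_le (subtopology X T) c"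
  shows "edim_le X c"
proof (rule edim_leI_restrict)
  fix N U and f :: "(nat \<Rightarrow> real) \<Rightarrow> 'a"
  assume U: "openin (Euclidean_space N) U" "U \<noteq> {}"
    and f: "continuous_map (subtopology (Euclidean_space N) U) X f"
  obtain u where "u \<in> U" using U by blast
  then have "f u \<in> topspace X"
    using continuous_map_openin_in_topspace[OF U(1) f] by blast
  then obtain T where "openin X T" "f u \<in> T" "edim_le (subtopology X T) c"
    using assms by blast
  with \<open>u \<in> U\<close> openin_preimage_subtopology[OF U(1) f]
  show "\<exists>T. openin (Euclidean_space N) {u \<in> U. f u \<in> T} \<and> {u \<in> U. f u \<in> T} \<noteq> {} \<and>
         edim_le (subtopology X T) c"
    by blast
qed

text \<open>A dichotomy replaces the sum theorem of dimension theory: either the plot stays in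
  \<open>C\<close>, or a nonempty open part of its domain is mapped into the complement.\<close>

lemma edim_le_closed_open:
  assumes C: "closedin X C" and "edim_le (subtopology X C) c"
    and "edim_le (subtopology X (topspace X - C)) c"
  shows "edim_le X c"
proof (rule edim_leI_restrict)
  fix N U and f :: "(nat \<Rightarrow> real) \<Rightarrow> 'a"
  assume U: "openin (Euclidean_space N) U" "U \<noteq> {}"
    and f: "continuous_map (subtopology (Euclidean_space N) U) X f"
  have fX: "f u \<in> topspace X" if "u \<in> U" for u
    using continuous_map_openin_in_topspace[OF U(1) f] that .
  show "\<exists>T. openin (Euclidean_space N) {u \<in> U. f u \<in> T} \<and> {u \<in> U. f u \<in> T} \<noteq> {} \<and>
         edim_le (subtopology X T) c"
  proof (cases "\<forall>u\<in>U. f u \<in> C")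
    case True
    then have "{u \<in> U. f u \<in> C} = U" by auto
    then show ?thesis
      using U assms(2) by (intro exI[of _ C]) simp
  next
    case False
    then have "{u \<in> U. f u \<in> topspace X - C} \<noteq> {}"
      using fX by auto
    moreover have "openin (Euclidean_space N) {u \<in> U. f u \<in> topspace X - C}"
      using C by (intro openin_preimage_subtopology[OF U(1) f]) (simp add: closedin_def)
    ultimately show ?thesis using assms by blast
  qed
qed

section \<open>Invariance of domain and products with intervals\<close>

theorem invariance_of_dimension_injective:
  assumes U: "openin (Euclidean_space N) U" "U \<noteq> {}"
    and f: "continuous_map (subtopology (Euclidean_space N) U) (Euclidean_space c) f" "inj_on f U"
  shows "N \<le> c"
proof (rule ccontr)
  assume "\<not> N \<le> c"
  then have cN: "c < N" by simp
  have sub: "topspace (Euclidean_space c) \<subseteq> topspace (Euclidean_space N)"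
    using cN by simp
  have fc: "f ` U \<subseteq> topspace (Euclidean_space c)"
    using continuous_map_openin_in_topspace[OF U(1) f(1)] by blast
  \<comment> \<open>R^c lies in R^N as the set where the coordinates from \<open>c\<close> on
    vanish, so invariance of domain makes the image of \<open>U\<close> open in R^N.\<close>
  have "continuous_map (subtopology (Euclidean_space N) U) (Euclidean_space N) f"
    using f(1) sub unfolding Euclidean_space_def continuous_map_in_subtopology by auto
  then have op: "openin (Euclidean_space N) (f ` U)"
    using U f(2) invariance_of_domain_Euclidean_space by blast
  obtain u where u: "u \<in> U" using U by blast
  \<comment> \<open>The line through \<open>f u\<close> in direction \<open>c\<close>, a coordinate
    that vanishes on the whole image. It meets the image only at \<open>t = 0\<close>, although the
    preimage of the image must be open in the line.\<close>
  let ?l = "\<lambda>t i. if i < N then (if i = c then t else f u i) else (0::real)"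
  have l: "continuous_map euclideanreal (Euclidean_space N) ?l"
    unfolding continuous_map_componentwise_Euclidean_space by auto
  have fu0: "f u i = 0" if "i \<ge> c" for i
    using fc u that by (auto simp: topspace_Euclidean_space)
  have "{t. ?l t \<in> f ` U} = {0}"
  proof
    show "{t. ?l t \<in> f ` U} \<subseteq> {0}"
    proof
      fix t assume "t \<in> {t. ?l t \<in> f ` U}"
      then have "?l t \<in> topspace (Euclidean_space c)"
        using fc by blast
      then have "?l t c = 0"
        unfolding topspace_Euclidean_space by blast
      then show "t \<in> {0}" using cN by simp
    qed
    have "?l 0 = f u"
      using fu0 cN by (auto simp: fun_eq_iff)
    then show "{0} \<subseteq> {t. ?l t \<in> f ` U}" using u by auto
  qed
  moreover have "open {t. ?l t \<in> f ` U}"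
    using openin_continuous_map_preimage[OF l op] by simp
  ultimately show False
    using not_open_singleton[of "0::real"] by simp
qed

text \<open>\<open>f\<close> and \<open>g\<close> are juxtaposed to one injection into R^(c+k), so
  the auxiliary map asks for nothing beyond invariance of domain.\<close>

lemma edim_le_Euclidean_space: "edim_le (Euclidean_space c) c"
  unfolding edim_le_def
proof (intro allI impI)
  fix N k U f g
  assume U: "openin (Euclidean_space N) U" "U \<noteq> {}"
    and f: "continuous_map (subtopology (Euclidean_space N) U) (Euclidean_space c) f"
    and g: "continuous_map (subtopology (Euclidean_space N) U) (Euclidean_space k) g"
    and i: "inj_on (\<lambda>u. (f u, g u)) U"
  have fc: "f u \<in> topspace (Euclidean_space c)" and gk: "g u \<in> topspace (Euclidean_space k)"
    if "u \<in> U" for u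
    using continuous_map_openin_in_topspace[OF U(1) f] continuous_map_openin_in_topspace[OF U(1) g]
      that by auto
  have comp: "continuous_map (subtopology (Euclidean_space N) U) euclideanreal (\<lambda>u. g u i)"
             "continuous_map (subtopology (Euclidean_space N) U) euclideanreal (\<lambda>u. f u i)" for i
    using f g unfolding Euclidean_space_def continuous_map_in_subtopology
    by (auto simp: continuous_map_componentwise_UNIV)
  let ?h = "\<lambda>u i. if i < c + k then (if i < c then f u i else g u (i - c)) else 0"
  have "continuous_map (subtopology (Euclidean_space N) U) (Euclidean_space (c + k)) ?h"
    unfolding continuous_map_componentwise_Euclidean_space using comp by auto
  moreover have "inj_on ?h U"
  proof (rule inj_onI)
    fix u v assume uv: "u \<in> U" "v \<in> U" "?h u = ?h v"
    from fun_cong[OF uv(3)] have eq: "?h u i = ?h v i" for i .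
    have "f u i = f v i" for i
      using eq[of i] fc uv(1,2) by (cases "i < c") (auto simp: topspace_Euclidean_space)
    moreover have "g u i = g v i" for i
      using eq[of "c + i"] gk uv(1,2) by (cases "i < k") (auto simp: topspace_Euclidean_space)
    ultimately have "(f u, g u) = (f v, g v)" by auto
    then show "u = v"
      using i uv by (auto simp: inj_on_def)
  qed
  ultimately show "N \<le> c + k"
    by (rule invariance_of_dimension_injective[OF U])
qed

lemma edim_ge_times_interval:
  assumes "edim_ge X N"
  shows "edim_ge (prod_topology X (top_of_set {0<..<1::real})) (Suc N)"
proof -
  let ?E = "Euclidean_space N" and ?E' = "Euclidean_space (Suc N)"
  obtain U f where U: "openin ?E U" "U \<noteq> {}"
      and f: "continuous_map (subtopology ?E U) X f" "inj_on f U"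
    using assms by (auto simp: edim_ge_def)
  define r where "r = (\<lambda>v::nat \<Rightarrow> real. \<lambda>i. if i < N then v i else 0)"
  have coord: "continuous_map ?E' euclideanreal (\<lambda>v. v i)" for i
    unfolding Euclidean_space_def
    by (intro continuous_map_from_subtopology continuous_map_product_projection) simp
  have r: "continuous_map ?E' ?E r"
    unfolding r_def continuous_map_componentwise_Euclidean_space using coord by auto
  \<comment> \<open>\<open>V\<close> is \<open>U\<close> times the open unit interval, the latter as
    coordinate \<open>N\<close>, which \<open>r\<close> forgets. The value 1/2 below shows that it
    is nonempty.\<close>
  define V where "V = {v \<in> topspace ?E'. r v \<in> U} \<inter> {v \<in> topspace ?E'. v N \<in> {0<..<1}}"
  have V: "openin ?E' V"
    unfolding V_def
    by (intro openin_Int openin_continuous_map_preimage[OF r U(1)]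
        openin_continuous_map_preimage[OF coord]) simp
  obtain u where u: "u \<in> U" using U by blast
  then have u0: "u i = 0" if "i \<ge> N" for i
    using openin_subset[OF U(1)] that by (auto simp: topspace_Euclidean_space)
  have "r (u(N := 1/2)) = u"
    using u0 by (auto simp: r_def fun_eq_iff)
  then have "u(N := 1/2) \<in> V"
    using u u0 by (auto simp: V_def topspace_Euclidean_space)
  moreover have "continuous_map (subtopology ?E' V) (prod_topology X (top_of_set {0<..<1::real}))
      (\<lambda>v. (f (r v), v N))"
  proof -
    have "continuous_map (subtopology ?E' V) (subtopology ?E U) r"
      using continuous_map_from_subtopology[OF r, of V]
      by (auto simp: continuous_map_in_subtopology V_def)
    then have "continuous_map (subtopology ?E' V) X (f \<circ> r)"
      using f(1) by (rule continuous_map_compose)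
    moreover have "continuous_map (subtopology ?E' V) (top_of_set {0<..<1::real}) (\<lambda>v. v N)"
      using continuous_map_from_subtopology[OF coord, of V N]
      by (auto simp: continuous_map_in_subtopology V_def)
    ultimately show ?thesis
      by (simp add: continuous_map_pairwise o_def)
  qed
  moreover have "inj_on (\<lambda>v. (f (r v), v N)) V"
  proof (rule inj_onI)
    fix v w assume vw: "v \<in> V" "w \<in> V" "(f (r v), v N) = (f (r w), w N)"
    then have "r v = r w"
      using f(2) by (auto simp: V_def inj_on_def)
    then have "v i = w i" if "i < N" for i
      using that by (auto simp: r_def dest: fun_cong[where x = i])
    moreover have "v i = w i" if "i \<ge> Suc N" for i
      using vw(1,2) that by (auto simp: V_def topspace_Euclidean_space)
    ultimately show "v = w"
      using vw(3) by (metis Suc_leI ext linorder_neqE_nat prod.inject)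
  qed
  ultimately show ?thesis
    using V unfolding edim_ge_def by blast
qed

lemma edim_le_subset:
  assumes "edim_le (subtopology X T) c" "T' \<subseteq> T"
  shows "edim_le (subtopology X T') c"
proof (rule edim_le_inj[OF assms(1)])
  show "continuous_map (subtopology X T') (subtopology X T) id"
    using assms(2) by (auto simp: continuous_map_in_subtopology continuous_map_from_subtopology)
qed auto

lemma edim_ge_superset:
  assumes "edim_ge (subtopology X T) c" "T \<subseteq> T'"
  shows "edim_ge (subtopology X T') c"
proof (rule edim_ge_inj[OF assms(1)])
  show "continuous_map (subtopology X T) (subtopology X T') id"
    using assms(2) by (auto simp: continuous_map_in_subtopology continuous_map_from_subtopology)
qed auto


section \<open>CW-complexes\<close>

lemma continuous_map_Euclidean_norm:
  "continuous_map (Euclidean_space k) euclideanreal (\<lambda>x. \<Sum>i<k. (x i)\<^sup>2)"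
proof -
  have "continuous_map (Euclidean_space k) euclideanreal (\<lambda>x. x i)" for i
    unfolding Euclidean_space_def
    by (intro continuous_map_from_subtopology continuous_map_product_projection) simp
  then show ?thesis
    by (intro continuous_map_sum continuous_map_real_pow) auto
qed

lemma topspace_disc: "topspace (disc k) = {x \<in> topspace (Euclidean_space k). (\<Sum>i<k. (x i)\<^sup>2) \<le> 1}"
  by (auto simp: disc_def)

lemma closedin_disc: "closedin (Euclidean_space k) (topspace (disc k))"
  using closedin_continuous_map_preimage[OF continuous_map_Euclidean_norm, of "{..1}" k]
  by (simp add: topspace_disc)

lemma openin_disc_interior: "openin (Euclidean_space k) (disc_interior k)"
proof -
  have "disc_interior k = {x \<in> topspace (Euclidean_space k). (\<Sum>i<k. (x i)\<^sup>2) \<in> {..<1}}"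
    by (auto simp: disc_interior_def topspace_disc)
  then show ?thesis
    using openin_continuous_map_preimage[OF continuous_map_Euclidean_norm, of "{..<1}" k] by simp
qed

text \<open>Euclidean space is a subspace of a power of the real line here, so Tychonoff's theorem
  makes the cube of sequences in [-1,1] compact, and the disc is closed in it.\<close>

lemma compact_space_disc: "compact_space (disc k)"
proof -
  let ?P = "powertop_real (UNIV :: nat set)"
  have "compactin ?P (PiE UNIV (\<lambda>i. {-1..1}))"
    by (simp add: compactin_PiE)
  moreover have "topspace (disc k) \<subseteq> PiE UNIV (\<lambda>i. {-1..1})"
  proof
    fix x assume x: "x \<in> topspace (disc k)"
    have "\<bar>x i\<bar> \<le> 1" for i
    proof (cases "i < k")
      case True
      then have "(x i)\<^sup>2 \<le> (\<Sum>i<k. (x i)\<^sup>2)"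
        by (intro member_le_sum) auto
      then have "(x i)\<^sup>2 \<le> 1"
        using x by (simp add: topspace_disc)
      then show ?thesis
        by (simp add: abs_square_le_1)
    next
      case False
      then show ?thesis
        using x by (simp add: topspace_disc topspace_Euclidean_space)
    qed
    then show "x \<in> PiE UNIV (\<lambda>i. {-1..1})"
      by (auto simp: abs_le_iff)
  qed
  moreover have "closedin ?P (topspace (disc k))"
  proof (rule closedin_trans_full[OF _ closedin_Euclidean_space])
    show "closedin (subtopology ?P (topspace (Euclidean_space k))) (topspace (disc k))"
      using closedin_disc[of k] by (simp add: Euclidean_space_def)
  qed
  ultimately have "compactin ?P (topspace (disc k))"
    by (meson closed_compactin)
  moreover have "disc k = subtopology ?P (topspace (disc k))"
    unfolding disc_def Euclidean_space_def subtopology_subtopology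
    by (simp add: Int_def)
  ultimately show ?thesis
    by (simp add: compactin_subspace)
qed

lemma closedin_disc_boundary: "closedin (disc k) (disc_boundary k)"
proof -
  have "continuous_map (disc k) euclideanreal (\<lambda>x. \<Sum>i<k. (x i)\<^sup>2)"
    unfolding disc_def by (intro continuous_map_from_subtopology continuous_map_Euclidean_norm)
  from closedin_continuous_map_preimage[OF this, of "{1}"] show ?thesis
    by (simp add: disc_boundary_def)
qed

section \<open>Cells of a CW-complex\<close>

locale CW =
  fixes X :: "'a topology" and E d \<Phi>
  assumes CW: "CW_structure X E d \<Phi>"
begin

lemma Hausdorff: "Hausdorff_space X"
  and partition: "partition_on (topspace X) E"
  and continuous: "e \<in> E \<Longrightarrow> continuous_map (disc (d e)) X (\<Phi> e)"
  and homeomorphic: "e \<in> E \<Longrightarrow> homeomorphic_map (subtopology (disc (d e)) (disc_interior (d e)))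
                              (subtopology X e) (\<Phi> e)"
  and closure_finite: "e \<in> E \<Longrightarrow> \<exists>F. finite F \<and> F \<subseteq> {e' \<in> E. d e' < d e} \<and> \<Phi> e ` disc_boundary (d e) \<subseteq> \<Union>F"
  and weak: "C \<subseteq> topspace X \<Longrightarrow> (\<And>e. e \<in> E \<Longrightarrow> closedin X (C \<inter> X closure_of e)) \<Longrightarrow> closedin X C"
  using CW unfolding CW_structure_def by simp_all

lemma Union_cells: "\<Union>E = topspace X"
  using partition by (simp add: partition_on_def)

lemma cell_subset: "e \<in> E \<Longrightarrow> e \<subseteq> topspace X"
  using partition by (auto simp: partition_on_def)

lemma cell_unique: "\<lbrakk>e \<in> E; e' \<in> E; x \<in> e; x \<in> e'\<rbrakk> \<Longrightarrow> e = e'"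
  using partition_onD2[OF partition] unfolding disjoint_def by blast

lemma cell_image:
  assumes "e \<in> E" shows "\<Phi> e ` disc_interior (d e) = e"
proof -
  have "topspace (subtopology (disc (d e)) (disc_interior (d e))) = disc_interior (d e)"
    by (auto simp: disc_interior_def)
  then show ?thesis
    using homeomorphic[OF assms] cell_subset[OF assms]
    by (metis homeomorphic_imp_surjective_map topspace_subtopology_subset)
qed

lemma closed_image:
  assumes "e \<in> E" "closedin (disc (d e)) K"
  shows "closedin X (\<Phi> e ` K)"
proof -
  have "compactin (disc (d e)) K"
    using assms(2) compact_space_disc by (simp add: closedin_compact_space)
  then show ?thesis
    using continuous[OF assms(1)] Hausdorff by (metis compactin_imp_closedin image_compactin)
qed

lemma closure_cell_subset:
  assumes "e \<in> E" shows "X closure_of e \<subseteq> e \<union> \<Phi> e ` disc_boundary (d e)"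
proof -
  have "topspace (disc (d e)) = disc_interior (d e) \<union> disc_boundary (d e)"
    by (auto simp: disc_interior_def disc_boundary_def topspace_disc)
  then have im: "\<Phi> e ` topspace (disc (d e)) = e \<union> \<Phi> e ` disc_boundary (d e)"
    using cell_image[OF assms] by (simp add: image_Un)
  moreover have "closedin X (\<Phi> e ` topspace (disc (d e)))"
    using closed_image[OF assms] by simp
  ultimately show ?thesis
    by (metis Un_upper1 closure_of_minimal)
qed

text \<open>Among cells of equal dimension the choice is free as long as all lower cells are
  included. So all cells of dimension at most k except one of dimension k form a closed set, which
  is how a single cell becomes relatively open.\<close>

lemma closedin_Union_cells:
  assumes GE: "G \<subseteq> E" and down: "\<And>e e'. e \<in> G \<Longrightarrow> e' \<in> E \<Longrightarrow> d e' < d e \<Longrightarrow> e' \<in> G"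
  shows "closedin X (\<Union>G)"
proof (rule weak)
  show "\<Union>G \<subseteq> topspace X"
    using GE cell_subset by blast
  fix e assume "e \<in> E"
  then show "closedin X (\<Union>G \<inter> X closure_of e)"
  proof (induction "d e" arbitrary: e rule: less_induct)
    case less
    obtain F where F: "finite F" "F \<subseteq> {e' \<in> E. d e' < d e}" "\<Phi> e ` disc_boundary (d e) \<subseteq> \<Union>F"
      using closure_finite[OF less.prems] by blast
    show ?case
    proof (cases "e \<in> G")
      case True
      then have "F \<subseteq> G" using F(2) down by blast
      then have "\<Union>G \<inter> X closure_of e = X closure_of e"
        using closure_cell_subset[OF less.prems] F(3) True by blast
      then show ?thesis by simp
    next
      case False
      have disj: "x \<notin> e" if "x \<in> \<Union>G" for x
        using that False GE less.prems cell_unique by blast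
      have cl: "f \<subseteq> X closure_of f" if "f \<in> F" for f
        using that F(2) cell_subset by (metis (mono_tags, lifting) closure_of_subset mem_Collect_eq subsetD)
      \<comment> \<open>Open cells are disjoint, so \<open>G\<close> meets the closure of
        \<open>e\<close> only in the boundary image. Finitely many cells of smaller dimension cover
        that image, and the induction hypothesis applies to their closures.\<close>
      have "\<Union>G \<inter> X closure_of e = X closure_of e \<inter> (\<Phi> e ` disc_boundary (d e) \<inter>
          (\<Union>f\<in>F. \<Union>G \<inter> X closure_of f))" (is "?l = ?r")
      proof
        show "?l \<subseteq> ?r"
        proof
          fix x assume x: "x \<in> ?l"
          then have xb: "x \<in> \<Phi> e ` disc_boundary (d e)"
            using closure_cell_subset[OF less.prems] disj by blast
          then obtain f where "f \<in> F" "x \<in> f"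
            using F(3) by blast
          then show "x \<in> ?r"
            using x xb cl by blast
        qed
      qed blast
      moreover have "closedin X (\<Phi> e ` disc_boundary (d e))"
        using closed_image[OF less.prems] closedin_disc_boundary by blast
      moreover have "closedin X (\<Union>f\<in>F. \<Union>G \<inter> X closure_of f)"
        using less.hyps F(1,2) by (intro closedin_Union) auto
      ultimately show ?thesis
        by (simp add: closedin_Int)
    qed
  qed
qed

text \<open>As dimensions are bounded, some cell met by the plot has the largest dimension. Its
  preimage is open and nonempty, and the plot is shrunk to it.\<close>

lemma edim_le_cells:
  assumes bounded: "\<And>e. e \<in> E \<Longrightarrow> d e \<le> N"
    and cells: "\<And>e. e \<in> E \<Longrightarrow> edim_le (subtopology X e) c"
  shows "edim_le X c"
proof (rule edim_leI_restrict)
  fix M U and f :: "(nat \<Rightarrow> real) \<Rightarrow> 'a"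
  assume U: "openin (Euclidean_space M) U" "U \<noteq> {}"
    and f: "continuous_map (subtopology (Euclidean_space M) U) X f"
  have fX: "f u \<in> \<Union>E" if "u \<in> U" for u
    unfolding Union_cells by (rule continuous_map_openin_in_topspace[OF U(1) f that])
  define I where "I = {e \<in> E. \<exists>u\<in>U. f u \<in> e}"
  have "finite (d ` I)"
  proof (rule finite_subset)
    show "d ` I \<subseteq> {..N}"
      using bounded unfolding I_def by blast
  qed simp
  moreover have "d ` I \<noteq> {}"
    using U(2) fX unfolding I_def by blast
  ultimately have "Max (d ` I) \<in> d ` I" and max: "\<And>e. e \<in> I \<Longrightarrow> d e \<le> Max (d ` I)"
    by simp_all
  then obtain e where "e \<in> I" "Max (d ` I) = d e"
    by blast
  with max have e: "e \<in> I" "\<And>e'. e' \<in> I \<Longrightarrow> d e' \<le> d e"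
    by simp_all
  \<comment> \<open>\<open>G\<close> contains every cell met by the plot except \<open>e\<close>; on
    the image of the plot, avoiding \<open>G\<close> therefore means lying in
    \<open>e\<close>.\<close>
  define G where "G = {e' \<in> E. d e' \<le> d e \<and> e' \<noteq> e}"
  have "closedin X (\<Union>G)"
    by (rule closedin_Union_cells) (auto simp: G_def)
  then have "openin (Euclidean_space M) {u \<in> U. f u \<in> topspace X - \<Union>G}"
    by (intro openin_preimage_subtopology[OF U(1) f]) (simp add: closedin_def)
  moreover have "f u \<in> topspace X - \<Union>G \<longleftrightarrow> f u \<in> e" if u: "u \<in> U" for u
  proof -
    obtain e' where e': "e' \<in> E" "f u \<in> e'" using fX[OF u] by blast
    have "e' \<in> I" using e' u by (auto simp: I_def)
    then have "d e' \<le> d e" using e(2) by blast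
    moreover have "e \<in> E" using e(1) by (simp add: I_def)
    ultimately show ?thesis
    proof (intro iffI)
      assume "f u \<in> topspace X - \<Union>G"
      then have "e' \<notin> G" using e'(2) by blast
      then show "f u \<in> e"
        using e' \<open>d e' \<le> d e\<close> by (simp add: G_def)
    next
      assume "f u \<in> e"
      then have "f u \<notin> e''" if "e'' \<in> G" for e''
        using that cell_unique[OF \<open>e \<in> E\<close>, of e''] by (auto simp: G_def)
      then show "f u \<in> topspace X - \<Union>G"
        using cell_subset[OF e'(1)] e'(2) by blast
    qed
  qed
  then have "{u \<in> U. f u \<in> topspace X - \<Union>G} = {u \<in> U. f u \<in> e}" by blast
  ultimately show "\<exists>T. openin (Euclidean_space M) {u \<in> U. f u \<in> T} \<and> {u \<in> U. f u \<in> T} \<noteq> {} \<and>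
         edim_le (subtopology X T) c"
    using e(1) cells by (intro exI[of _ e]) (auto simp: I_def)
qed

lemma subtopology_disc_interior:
  "subtopology (disc k) (disc_interior k) = subtopology (Euclidean_space k) (disc_interior k)"
proof -
  have "{x. (\<Sum>i<k. (x i)\<^sup>2) \<le> 1} \<inter> disc_interior k = disc_interior k"
    by (auto simp: disc_interior_def disc_def)
  then show ?thesis
    by (simp add: disc_def subtopology_subtopology)
qed

lemma edim_le_cell:
  assumes "e \<in> E" shows "edim_le (subtopology X e) (d e)"
proof -
  obtain g where g: "homeomorphic_maps (subtopology (Euclidean_space (d e)) (disc_interior (d e)))
      (subtopology X e) (\<Phi> e) g"
    using homeomorphic[OF assms] by (auto simp: homeomorphic_map_maps subtopology_disc_interior)
  show ?thesis
  proof (rule edim_le_inj[OF edim_le_Euclidean_space])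
    show "continuous_map (subtopology X e) (Euclidean_space (d e)) g"
      using g by (auto simp: homeomorphic_maps_def continuous_map_in_subtopology)
    show "inj_on g (topspace (subtopology X e))"
      using g unfolding homeomorphic_maps_def by (metis inj_on_inverseI)
  qed
qed

text \<open>Points of a Hausdorff space are closed, so deleting \<open>a\<close> leaves an open part
  of the cell, which is nonempty unless the cell is \<open>{a}\<close>.\<close>

lemma edim_ge_punctured:
  assumes "e \<in> E" "e \<noteq> {a}" "a \<in> topspace X"
  shows "edim_ge (subtopology X (topspace X - {a})) (d e)"
proof -
  let ?E = "Euclidean_space (d e)"
  let ?I = "disc_interior (d e)"
  have "continuous_map (subtopology ?E ?I) (subtopology X e) (\<Phi> e)"
    using homeomorphic[OF assms(1)]
    by (auto simp: subtopology_disc_interior dest: homeomorphic_imp_continuous_map)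
  then have c: "continuous_map (subtopology ?E ?I) X (\<Phi> e)"
    by (simp add: continuous_map_in_subtopology)
  have inj: "inj_on (\<Phi> e) ?I"
    using homeomorphic_imp_injective_map[OF homeomorphic[OF assms(1)]]
    unfolding subtopology_disc_interior topspace_subtopology_openin[OF openin_disc_interior] .
  let ?U = "{x \<in> ?I. \<Phi> e x \<in> topspace X - {a}}"
  have "openin X (topspace X - {a})"
    using Hausdorff assms(3) by (metis closedin_Hausdorff_singleton closedin_def)
  then have U: "openin ?E ?U"
    by (rule openin_preimage_subtopology[OF openin_disc_interior c])
  have "e \<noteq> {}"
    using partition assms(1) by (auto simp: partition_on_def)
  then obtain b where "b \<in> e" "b \<noteq> a"
    using assms(2) by blast
  then have "?U \<noteq> {}"
    using cell_image[OF assms(1)] cell_subset[OF assms(1)] by blast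
  moreover have "continuous_map (subtopology ?E ?U) (subtopology X (topspace X - {a})) (\<Phi> e)"
    using continuous_map_from_subtopology_mono[OF c, of ?U]
    by (auto simp: continuous_map_in_subtopology)
  moreover have "inj_on (\<Phi> e) ?U"
    using inj by (rule inj_on_subset) auto
  ultimately show ?thesis
    using U unfolding edim_ge_def by blast
qed

end

lemma edim_le_singleton: "edim_le (subtopology X {a}) 0"
proof (rule edim_le_inj[OF edim_le_Euclidean_space])
  show "continuous_map (subtopology X {a}) (Euclidean_space 0) (\<lambda>_ _. 0)"
    by (simp add: topspace_Euclidean_space)
qed (auto intro: inj_onI)

text \<open>Comparing two structures requires both bounds with the same \<open>c\<close>; a cell of
  largest dimension provides them.\<close>

lemma finite_dimensional_CW_complex_edim:
  assumes "finite_dimensional_CW_complex X" "a \<in> topspace X" "topspace X \<noteq> {a}"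
  obtains c where "Hausdorff_space X" "edim_le X c" "edim_ge (subtopology X (topspace X - {a})) c"
proof -
  obtain E d \<Phi> N where cw: "CW_structure X E d \<Phi>" and N: "\<forall>e\<in>E. d e \<le> N"
    using assms(1) unfolding finite_dimensional_CW_complex_def by blast
  interpret CW X E d \<Phi> using cw by unfold_locales
  \<comment> \<open>A cell \<open>{a}\<close> would contribute nothing to the lower bound.\<close>
  let ?I = "{e \<in> E. e \<noteq> {a}}"
  define c where "c = Max (d ` ?I)"
  have "finite (d ` ?I)"
    using N by (intro finite_subset[of "d ` ?I" "{..N}"]) auto
  moreover have "d ` ?I \<noteq> {}"
  proof -
    obtain b where "b \<in> topspace X" "b \<noteq> a" using assms(2,3) by blast
    then show ?thesis
      using partition by (fastforce simp: partition_on_def)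
  qed
  ultimately have "c \<in> d ` ?I" and max: "\<And>e. e \<in> ?I \<Longrightarrow> d e \<le> c"
    by (auto simp: c_def simp del: mem_Collect_eq)
  then obtain e where e: "e \<in> E" "e \<noteq> {a}" "c = d e" by blast
  have "edim_le (subtopology X e') c" if "e' \<in> E" for e'
  proof (cases "e' = {a}")
    case True
    then show ?thesis
      using edim_le_mono[OF edim_le_singleton] by simp
  next
    case False
    then show ?thesis
      using max[of e'] edim_le_mono[OF edim_le_cell[OF that]] that by simp
  qed
  then have "edim_le X c"
    using N by (intro edim_le_cells) auto
  then show ?thesis
    using that[OF Hausdorff] edim_ge_punctured[OF e(1,2) assms(2)] e(3) by simp
qed

section \<open>Quotients, cylinders and wedges\<close>

lemma closedin_collapse:
  "closedin (topo (collapse X S)) T \<longleftrightarrow>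
     T \<subseteq> topspace (topo (collapse X S)) \<and> closedin X {x \<in> topspace X. collapse_proj S x \<in> T}"
proof (cases "T \<subseteq> topspace (topo (collapse X S))")
  case True
  have "{x \<in> topspace X. collapse_proj S x \<in> topspace (topo (collapse X S)) - T} =
        topspace X - {x \<in> topspace X. collapse_proj S x \<in> T}"
    by (auto simp: topspace_collapse collapse_proj_def)
  then show ?thesis
    using True by (auto simp: closedin_def openin_collapse topspace_collapse)
qed (auto simp: closedin_def)

lemma closedin_collapse_pt: "closedin X S \<Longrightarrow> closedin (topo (collapse X S)) {None}"
proof -
  assume S: "closedin X S"
  then have "{x \<in> topspace X. collapse_proj S x \<in> {None}} = S"
    using closedin_subset[OF S] by (auto simp: collapse_proj_def)
  then show ?thesis
    using S by (simp add: closedin_collapse topspace_collapse)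
qed

lemma continuous_map_collapse_Some:
  assumes "R \<subseteq> topspace X - S"
  shows "continuous_map (subtopology X R) (subtopology (topo (collapse X S)) (Some ` R)) Some"
proof -
  have "openin (subtopology X R) {x \<in> topspace (subtopology X R). Some x \<in> T}"
    if "openin (topo (collapse X S)) T" for T
  proof -
    have "{x \<in> topspace (subtopology X R). Some x \<in> T} = {x \<in> topspace X. collapse_proj S x \<in> T} \<inter> R"
      using assms by (auto simp: collapse_proj_def)
    then show ?thesis
      using that by (auto simp: openin_collapse openin_subtopology)
  qed
  then have "continuous_map (subtopology X R) (topo (collapse X S)) Some"
    using assms by (auto simp: continuous_map_def topspace_collapse)
  then show ?thesis
    by (auto simp: continuous_map_in_subtopology)
qed

lemma edim_ge_collapse:
  assumes "R \<subseteq> topspace X - S" "edim_ge (subtopology X R) c"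
  shows "edim_ge (subtopology (topo (collapse X S)) (Some ` R)) c"
  by (rule edim_ge_inj[OF assms(2) continuous_map_collapse_Some[OF assms(1)]]) auto

text \<open>Since \<open>S\<close> is closed, open subsets of its complement are open and saturated
  in \<open>X\<close>. So the complement is an open subspace of the quotient, with
  \<open>the\<close> as continuous inverse of \<open>Some\<close>.\<close>

lemma edim_le_collapse:
  assumes S: "closedin X S" and c: "edim_le (subtopology X (topspace X - S)) c"
  shows "edim_le (subtopology (topo (collapse X S)) (topspace (topo (collapse X S)) - {None})) c"
proof (rule edim_le_inj[OF c])
  let ?Q = "topo (collapse X S)"
  let ?Q' = "subtopology ?Q (topspace ?Q - {None})"
  have top: "topspace ?Q' = Some ` (topspace X - S)"
    by (auto simp: topspace_collapse)
  have "openin ?Q' {y \<in> topspace ?Q'. the y \<in> T}"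
    if T: "openin (subtopology X (topspace X - S)) T" for T
  proof -
    have T': "openin X T" "T \<subseteq> topspace X - S"
      using T S by (auto simp: closedin_def openin_open_subtopology)
    then have "{x \<in> topspace X. collapse_proj S x \<in> Some ` T} = T"
      by (auto simp: collapse_proj_def)
    then have "openin ?Q (Some ` T)"
      using T' by (auto simp: openin_collapse)
    moreover have "{y \<in> topspace ?Q'. the y \<in> T} = Some ` T"
      using T' unfolding top by auto
    moreover have "Some ` T = Some ` T \<inter> (topspace ?Q - {None})"
      using T'(2) by (auto simp: topspace_collapse)
    ultimately show ?thesis
      unfolding openin_subtopology by metis
  qed
  moreover have "the y \<in> topspace (subtopology X (topspace X - S))" if "y \<in> topspace ?Q'" for y
    using that unfolding top by auto
  ultimately show "continuous_map ?Q' (subtopology X (topspace X - S)) the"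
    by (auto simp: continuous_map_def simp del: topspace_subtopology)
  show "inj_on the (topspace ?Q')"
    unfolding top by (auto simp: inj_on_def)
qed

section \<open>Punctured spaces, suspensions and cones\<close>

definition punctured :: "'a pointed \<Rightarrow> 'a topology" where
  "punctured X = subtopology (topo X) (topspace (topo X) - {pt X})"

text \<open>The invariant inherited by suspensions, with \<open>c\<close> raised by one each time. A
  closed base point is what makes the collapsed subsets of cylinders and sums closed.\<close>

definition has_punctured_edim :: "'a pointed \<Rightarrow> nat \<Rightarrow> bool" where
  "has_punctured_edim X c \<longleftrightarrow>
     closedin (topo X) {pt X} \<and> edim_le (punctured X) c \<and> edim_ge (punctured X) c"

lemma has_punctured_edim_relabel:
  assumes f: "inj f" and X: "has_punctured_edim X c"
  shows "has_punctured_edim (relabel f X) c"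
proof -
  let ?Y = "relabel f X"
  have h: "homeomorphic_map (topo X) (topo ?Y) f"
    by (rule homeomorphic_map_relabel[OF f])
  have pt: "pt ?Y = f (pt X)" by (simp add: relabel_def)
  have ptX: "pt X \<in> topspace (topo X)"
    using X closedin_subset by (fastforce simp: has_punctured_edim_def)
  have cl: "closedin (topo ?Y) {pt ?Y}"
    using h X ptX homeomorphic_map_closedness_eq[OF h, of "{pt X}"]
    unfolding pt has_punctured_edim_def by (metis image_empty image_insert)
  obtain g where g: "homeomorphic_maps (topo X) (topo ?Y) f g"
    using h by (auto simp: homeomorphic_map_maps)
  have "edim_ge (punctured ?Y) c"
  proof (rule edim_ge_inj)
    show "edim_ge (punctured X) c" using X by (simp add: has_punctured_edim_def)
    show "continuous_map (punctured X) (punctured ?Y) f"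
      using homeomorphic_imp_continuous_map[OF h] f unfolding punctured_def continuous_map_in_subtopology
      by (auto simp: topspace_relabel pt inj_def intro: continuous_map_from_subtopology)
    show "inj_on f (topspace (punctured X))"
      using f by (rule inj_on_subset) auto
  qed
  moreover have "edim_le (punctured ?Y) c"
  proof (rule edim_le_inj)
    show "edim_le (punctured X) c" using X by (simp add: has_punctured_edim_def)
    show "continuous_map (punctured ?Y) (punctured X) g"
      using g unfolding punctured_def continuous_map_in_subtopology homeomorphic_maps_def pt
      by (auto intro: continuous_map_from_subtopology dest: continuous_map_funspace)
    show "inj_on g (topspace (punctured ?Y))"
      using g unfolding homeomorphic_maps_def punctured_def
      by (metis Diff_subset inj_on_inverseI inj_on_subset topspace_subtopology_subset)
  qed
  ultimately show ?thesis
    using cl by (simp add: has_punctured_edim_def)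
qed

text \<open>Cone and suspension are treated at once: beyond the segment over the base point,
  \<open>C\<close> has only points of the two ends. The lower bound uses the open cylinder because
  the base of a cone, although not collapsed, is glued to another space later.\<close>

lemma cylinder_quotient_edim:
  fixes X :: "'a pointed"
  assumes X: "has_punctured_edim X c" and C: "closedin (cylinder X) C"
    and pt: "{pt X} \<times> {0..1} \<subseteq> C" and sub: "C \<subseteq> topspace (topo X) \<times> {0, 1} \<union> {pt X} \<times> {0..1}"
  defines "Q \<equiv> topo (collapse (cylinder X) C)"
  shows "edim_le (subtopology Q (topspace Q - {None})) (Suc c)"
    and "edim_ge (subtopology Q (Some ` ((topspace (topo X) - {pt X}) \<times> {0<..<1}))) (Suc c)"
proof -
  let ?R = "topspace (cylinder X) - C"
  have h: "continuous_map (subtopology (cylinder X) ?R) (punctured X) fst"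
    unfolding punctured_def using pt
    by (auto simp: continuous_map_in_subtopology intro: continuous_map_from_subtopology continuous_map_fst)
  have "continuous_map (cylinder X) euclideanreal snd"
    using continuous_map_snd[of "topo X" "top_of_set {0..1::real}"]
    by (simp add: continuous_map_in_subtopology)
  then have t: "continuous_map (subtopology (cylinder X) ?R) euclideanreal snd"
    by (rule continuous_map_from_subtopology)
  \<comment> \<open>Off \<open>C\<close> the projection to \<open>X\<close> avoids the base point,
    and the height is the extra real coordinate.\<close>
  have "edim_le (subtopology (cylinder X) ?R) (Suc c)"
    by (rule edim_le_times_real[OF _ h t]) (use X in \<open>auto simp: has_punctured_edim_def inj_on_def\<close>)
  then show "edim_le (subtopology Q (topspace Q - {None})) (Suc c)"
    unfolding Q_def by (rule edim_le_collapse[OF C])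
  have "top_of_set {0<..<1::real} = subtopology (top_of_set {0..1}) {0<..<1}"
  proof -
    have "{0..1::real} \<inter> {0<..<1} = {0<..<1}" by auto
    then show ?thesis by (simp add: subtopology_subtopology)
  qed
  then have "prod_topology (punctured X) (top_of_set {0<..<1::real}) =
        subtopology (cylinder X) ((topspace (topo X) - {pt X}) \<times> {0<..<1})"
    by (simp add: punctured_def subtopology_Times)
  moreover have "edim_ge (prod_topology (punctured X) (top_of_set {0<..<1::real})) (Suc c)"
    using X edim_ge_times_interval by (auto simp: has_punctured_edim_def)
  ultimately show "edim_ge (subtopology Q (Some ` ((topspace (topo X) - {pt X}) \<times> {0<..<1}))) (Suc c)"
    unfolding Q_def using sub by (intro edim_ge_collapse) auto
qed

lemma closedin_cone_collapsed:
  assumes "closedin (topo X) {pt X}"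
  shows "closedin (cylinder X) (cone_collapsed X)"
  unfolding cone_collapsed_def using assms
  by (intro closedin_Un) (auto simp: closedin_prod_Times_iff closedin_closed_eq)

lemma has_punctured_edim_suspension:
  assumes X: "has_punctured_edim X c"
  shows "has_punctured_edim (reduced_suspension X) (Suc c)"
proof -
  let ?C = "topspace (topo X) \<times> {0, 1} \<union> {pt X} \<times> {0..1::real}"
  have C: "closedin (cylinder X) ?C"
    using X by (intro closedin_Un)
      (auto simp: closedin_prod_Times_iff closedin_closed_eq has_punctured_edim_def)
  have pt: "pt (reduced_suspension X) = None"
    by (simp add: reduced_suspension_def collapse_def)
  note e = cylinder_quotient_edim[OF X C]
  have "edim_ge (punctured (reduced_suspension X)) (Suc c)"
    unfolding punctured_def pt unfolding reduced_suspension_def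
    by (rule edim_ge_superset[OF e(2)]) (auto simp: topspace_collapse)
  then show ?thesis
    using e(1) closedin_collapse_pt[OF C]
    unfolding has_punctured_edim_def punctured_def pt unfolding reduced_suspension_def by auto
qed

lemma has_punctured_edim_iter_suspension:
  "has_punctured_edim A c \<Longrightarrow> has_punctured_edim (iter_suspension n A) (c + n)"
proof (induction n)
  case 0
  then show ?case by (auto intro!: has_punctured_edim_relabel injI)
next
  case (Suc n)
  then show ?case
    by (auto intro!: has_punctured_edim_relabel has_punctured_edim_suspension injI)
qed

section \<open>Wedges\<close>

abbreviation wedge_points :: "'j set \<Rightarrow> ('j \<Rightarrow> 'a pointed) \<Rightarrow> ('j \<times> 'a) set" where
  "wedge_points J X \<equiv> {(j, pt (X j)) |j. j \<in> J}"

lemma pt_wedge: "pt (wedge J X) = None"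
  by (simp add: wedge_def collapse_def)

lemma closedin_wedge_points:
  assumes "\<And>j. j \<in> J \<Longrightarrow> closedin (topo (X j)) {pt (X j)}"
  shows "closedin (sum_topology (\<lambda>j. topo (X j)) J) (wedge_points J X)"
proof -
  have "wedge_points J X = Sigma J (\<lambda>j. {pt (X j)})" by auto
  then show ?thesis
    using assms by (simp add: closedin_disjoint_union)
qed

lemma topspace_wedge:
  "topspace (topo (wedge J X)) =
     insert None (Some ` (SIGMA j:J. topspace (topo (X j)) - {pt (X j)}))"
  by (auto simp: wedge_def topspace_collapse image_iff)

lemma closedin_wedge:
  "closedin (topo (wedge J X)) T \<longleftrightarrow>
     T \<subseteq> topspace (topo (wedge J X)) \<and>
     (\<forall>j\<in>J. closedin (topo (X j))
        {x \<in> topspace (topo (X j)). collapse_proj (wedge_points J X) (j, x) \<in> T})"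
proof -
  have "{x. (j, x) \<in> {y \<in> topspace (sum_topology (\<lambda>j. topo (X j)) J).
            collapse_proj (wedge_points J X) y \<in> T}} =
        {x \<in> topspace (topo (X j)). collapse_proj (wedge_points J X) (j, x) \<in> T}"
    if "j \<in> J" for j
    using that by auto
  then show ?thesis
    unfolding wedge_def closedin_collapse closedin_sum_topology by auto
qed

text \<open>The summands are open in the sum, and the bound is local.\<close>

lemma edim_le_sum_topology:
  assumes "\<And>j. j \<in> J \<Longrightarrow> edim_le (X j) c"
  shows "edim_le (sum_topology X J) c"
proof (rule edim_le_open_cover)
  fix x assume "x \<in> topspace (sum_topology X J)"
  then obtain j y where x: "x = (j, y)" "j \<in> J" "y \<in> topspace (X j)" by auto
  let ?T = "Pair j ` topspace (X j)"
  have T: "openin (sum_topology X J) ?T"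
    using open_map_component_injection[OF x(2), of X] by (simp add: open_map_def)
  have "homeomorphic_map (X j) (subtopology (sum_topology X J) ?T) (Pair j)"
    using embedding_map_component_injection[OF x(2), of X] by (simp add: embedding_map_def)
  then obtain g where g: "homeomorphic_maps (X j) (subtopology (sum_topology X J) ?T) (Pair j) g"
    by (auto simp: homeomorphic_map_maps)
  have "edim_le (subtopology (sum_topology X J) ?T) c"
  proof (rule edim_le_inj[OF assms[OF x(2)]])
    show "continuous_map (subtopology (sum_topology X J) ?T) (X j) g"
      using g by (simp add: homeomorphic_maps_def)
    show "inj_on g (topspace (subtopology (sum_topology X J) ?T))"
      using g unfolding homeomorphic_maps_def by (metis inj_on_inverseI)
  qed
  with T x show "\<exists>T. openin (sum_topology X J) T \<and> x \<in> T \<and> edim_le (subtopology (sum_topology X J) T) c"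
    by blast
qed

text \<open>Off the wedge point, a wedge is the disjoint union of its punctured summands.\<close>

lemma edim_le_wedge:
  assumes "\<And>j. j \<in> J \<Longrightarrow> closedin (topo (X j)) {pt (X j)}"
    and "\<And>j. j \<in> J \<Longrightarrow> edim_le (punctured (X j)) c"
  shows "edim_le (punctured (wedge J X)) c"
proof -
  let ?S = "sum_topology (\<lambda>j. topo (X j)) J"
  have "edim_le (sum_topology (\<lambda>j. punctured (X j)) J) c"
    by (rule edim_le_sum_topology[OF assms(2)])
  then have "edim_le (subtopology ?S (SIGMA j:J. topspace (topo (X j)) - {pt (X j)})) c"
    by (simp add: punctured_def subtopology_sum_topology)
  moreover have "(SIGMA j:J. topspace (topo (X j)) - {pt (X j)}) = topspace ?S - wedge_points J X"
    by auto
  ultimately show ?thesis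
    using edim_le_collapse[OF closedin_wedge_points, of J X c] assms(1)
    unfolding punctured_def pt_wedge unfolding wedge_def by simp
qed

lemma edim_ge_wedge:
  assumes "j \<in> J" "R \<subseteq> topspace (topo (X j)) - {pt (X j)}" "edim_ge (subtopology (topo (X j)) R) c"
  shows "edim_ge (subtopology (topo (wedge J X)) (Some ` Pair j ` R)) c"
proof -
  let ?S = "sum_topology (\<lambda>j. topo (X j)) J"
  have "edim_ge (subtopology ?S (Pair j ` R)) c"
  proof (rule edim_ge_inj[OF assms(3)])
    show "continuous_map (subtopology (topo (X j)) R) (subtopology ?S (Pair j ` R)) (Pair j)"
      using continuous_map_component_injection[OF assms(1), of "\<lambda>j. topo (X j)"]
      by (auto simp: continuous_map_in_subtopology intro: continuous_map_from_subtopology)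
  qed (auto intro: inj_onI)
  then show ?thesis
    unfolding wedge_def using assms(1,2) by (intro edim_ge_collapse) auto
qed


section \<open>Attaching cells\<close>

locale closed_pushout =
  fixes S :: "'s pointed" and g i and Z :: "'z pointed" and W :: "'w pointed"
    and P :: "'p pointed" and p q
  assumes pushout: "is_pushout S g i Z W P p q"
    and inj_i: "inj_on i (topspace (topo S))"
    and closed_i: "closed_map (topo S) (topo W) i"
begin

abbreviation "glue u v \<equiv> \<exists>s\<in>topspace (topo S). u = Inl (g s) \<and> v = Inr (i s)"

lemma g: "continuous_map (topo S) (topo Z) g"
  and i: "continuous_map (topo S) (topo W) i"
  and p: "continuous_map (topo Z) (topo P) p"
  and q: "continuous_map (topo W) (topo P) q"
  and quotient: "quotient_map (sum2_topology (topo Z) (topo W)) (topo P) (case_sum p q)"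
  and fibres: "\<lbrakk>x \<in> topspace (sum2_topology (topo Z) (topo W));
      y \<in> topspace (sum2_topology (topo Z) (topo W))\<rbrakk> \<Longrightarrow>
    case_sum p q x = case_sum p q y \<longleftrightarrow> equivclp glue x y"
  using pushout by (simp_all add: is_pushout_def pointed_map_def is_quotient_by_def)

lemma commutes: "s \<in> topspace (topo S) \<Longrightarrow> p (g s) = q (i s)"
  using is_pushout_commutes[OF pushout] .

text \<open>A normal form: every point of \<open>i S\<close> is moved to \<open>Z\<close>. It is constant on the classes of the
  gluing relation, so it separates the points that are not glued.\<close>

definition nf :: "'z + 'w \<Rightarrow> 'z + 'w" where
  "nf u = (case u of Inl z \<Rightarrow> Inl z
     | Inr w \<Rightarrow> if w \<in> i ` topspace (topo S)
                then Inl (g (inv_into (topspace (topo S)) i w)) else Inr w)"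

lemma equivclp_nf:
  assumes "equivclp glue u v"
  shows "nf u = nf v"
  using assms
proof (induction rule: equivclp_induct)
  case (step y z)
  then show ?case using inj_i by (auto simp: nf_def)
qed simp

lemma nf_eq:
  assumes "x \<in> topspace (topo Z) <+> topspace (topo W)" "y \<in> topspace (topo Z) <+> topspace (topo W)"
    and "case_sum p q x = case_sum p q y"
  shows "nf x = nf y"
  using assms fibres[of x y] equivclp_nf unfolding topspace_sum2_topology by blast

lemma inj_p: "inj_on p (topspace (topo Z))"
proof (rule inj_onI)
  fix x y assume "x \<in> topspace (topo Z)" "y \<in> topspace (topo Z)" "p x = p y"
  then show "x = y"
    using nf_eq[of "Inl x" "Inl y"] by (auto simp: nf_def)
qed

lemma inj_q: "inj_on q (topspace (topo W) - i ` topspace (topo S))"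
proof (rule inj_onI)
  fix x y
  assume "x \<in> topspace (topo W) - i ` topspace (topo S)"
    "y \<in> topspace (topo W) - i ` topspace (topo S)" "q x = q y"
  then show "x = y"
    using nf_eq[of "Inr x" "Inr y"] by (auto simp: nf_def)
qed

lemma p_neq_q:
  assumes "z \<in> topspace (topo Z)" "w \<in> topspace (topo W) - i ` topspace (topo S)"
  shows "p z \<noteq> q w"
  using nf_eq[of "Inl z" "Inr w"] assms by (auto simp: nf_def)

lemma closedin_iff:
  assumes "C \<subseteq> topspace (topo P)"
  shows "closedin (topo P) C \<longleftrightarrow>
    closedin (topo Z) {z \<in> topspace (topo Z). p z \<in> C} \<and>
    closedin (topo W) {w \<in> topspace (topo W). q w \<in> C}"
proof -
  let ?Q = "sum2_topology (topo Z) (topo W)"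
  have closed2: "closedin ?Q K \<longleftrightarrow> closedin (topo Z) (Inl -` K) \<and> closedin (topo W) (Inr -` K)"
    if "K \<subseteq> topspace ?Q" for K
  proof -
    have "Inl -` (topspace ?Q - K) = topspace (topo Z) - Inl -` K"
         "Inr -` (topspace ?Q - K) = topspace (topo W) - Inr -` K"
      by (auto simp: topspace_sum2_topology)
    then show ?thesis
      using that by (auto simp: closedin_def openin_sum2_topology topspace_sum2_topology)
  qed
  have "closedin (topo P) C \<longleftrightarrow> closedin ?Q {x \<in> topspace ?Q. case_sum p q x \<in> C}"
    using quotient assms unfolding quotient_map_closedin by blast
  also have "\<dots> \<longleftrightarrow> closedin (topo Z) {z \<in> topspace (topo Z). p z \<in> C} \<and>
    closedin (topo W) {w \<in> topspace (topo W). q w \<in> C}"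
  proof (subst closed2)
    have "Inl -` {x \<in> topspace ?Q. case_sum p q x \<in> C} = {z \<in> topspace (topo Z). p z \<in> C}"
         "Inr -` {x \<in> topspace ?Q. case_sum p q x \<in> C} = {w \<in> topspace (topo W). q w \<in> C}"
      by (auto simp: topspace_sum2_topology)
    then show "(closedin (topo Z) (Inl -` {x \<in> topspace ?Q. case_sum p q x \<in> C}) \<and>
       closedin (topo W) (Inr -` {x \<in> topspace ?Q. case_sum p q x \<in> C})) =
      (closedin (topo Z) {z \<in> topspace (topo Z). p z \<in> C} \<and>
       closedin (topo W) {w \<in> topspace (topo W). q w \<in> C})"
      by simp
  qed auto
  finally show ?thesis .
qed

lemma p_in: "z \<in> topspace (topo Z) \<Longrightarrow> p z \<in> topspace (topo P)"
  and q_in: "w \<in> topspace (topo W) \<Longrightarrow> q w \<in> topspace (topo P)"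
  and g_in: "s \<in> topspace (topo S) \<Longrightarrow> g s \<in> topspace (topo Z)"
  and i_in: "s \<in> topspace (topo S) \<Longrightarrow> i s \<in> topspace (topo W)"
  using p q g i by (auto simp: continuous_map_def)

text \<open>In \<open>W\<close>, the image of \<open>C\<close> pulls back to the points
  \<open>i s\<close> with \<open>g s\<close> in \<open>C\<close>. This set is closed because
  \<open>g\<close> is continuous and \<open>i\<close> is a closed map.\<close>

lemma closed_p: "closed_map (topo Z) (topo P) p"
  unfolding closed_map_def
proof (intro allI impI)
  fix C assume C: "closedin (topo Z) C"
  then have CZ: "C \<subseteq> topspace (topo Z)" by (rule closedin_subset)
  have "{z \<in> topspace (topo Z). p z \<in> p ` C} = C"
    using CZ inj_p by (auto simp: inj_on_def)
  moreover have "{w \<in> topspace (topo W). q w \<in> p ` C} = i ` {s \<in> topspace (topo S). g s \<in> C}"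
  proof
    show "{w \<in> topspace (topo W). q w \<in> p ` C} \<subseteq> i ` {s \<in> topspace (topo S). g s \<in> C}"
    proof
      fix w assume "w \<in> {w \<in> topspace (topo W). q w \<in> p ` C}"
      then obtain c where w: "w \<in> topspace (topo W)" "c \<in> C" "p c = q w" by auto
      then obtain s where s: "s \<in> topspace (topo S)" "w = i s"
        using p_neq_q CZ by blast
      then have "p c = p (g s)"
        using w(3) commutes by simp
      then have "c = g s"
        using inj_p CZ w(2) g_in[OF s(1)] by (auto simp: inj_on_def)
      then show "w \<in> i ` {s \<in> topspace (topo S). g s \<in> C}"
        using s w(2) by blast
    qed
    show "i ` {s \<in> topspace (topo S). g s \<in> C} \<subseteq> {w \<in> topspace (topo W). q w \<in> p ` C}"
      using i_in commutes by (auto simp flip: commutes)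
  qed
  moreover have "closedin (topo W) (i ` {s \<in> topspace (topo S). g s \<in> C})"
    using closed_i closedin_continuous_map_preimage[OF g C] by (auto simp: closed_map_def)
  ultimately show "closedin (topo P) (p ` C)"
    using C CZ p_in by (subst closedin_iff) auto
qed

lemma cover: "y \<in> topspace (topo P) - p ` topspace (topo Z) \<Longrightarrow>
    \<exists>w\<in>topspace (topo W) - i ` topspace (topo S). y = q w"
proof -
  assume y: "y \<in> topspace (topo P) - p ` topspace (topo Z)"
  have "topspace (topo P) = case_sum p q ` (topspace (topo Z) <+> topspace (topo W))"
    using quotient by (metis quotient_imp_surjective_map topspace_sum2_topology)
  then obtain x where "x \<in> topspace (topo Z) <+> topspace (topo W)" "y = case_sum p q x"
    using y by blast
  then obtain w where w: "w \<in> topspace (topo W)" "y = q w"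
    using y by auto
  moreover have "w \<notin> i ` topspace (topo S)"
    using w(2) y g_in by (auto simp flip: commutes)
  ultimately show ?thesis by blast
qed

lemma edim_ge_pushout:
  assumes "edim_ge (subtopology (topo W) (topspace (topo W) - i ` topspace (topo S))) c"
  shows "edim_ge (topo P) c"
proof (rule edim_ge_inj[OF assms])
  show "continuous_map (subtopology (topo W) (topspace (topo W) - i ` topspace (topo S))) (topo P) q"
    using q by (rule continuous_map_from_subtopology)
  show "inj_on q (topspace (subtopology (topo W) (topspace (topo W) - i ` topspace (topo S))))"
    using inj_q by (rule inj_on_subset) auto
qed

text \<open>\<open>P\<close> is split into a closed copy of \<open>Z\<close> and its complement,
  where \<open>q\<close> has a continuous inverse defined on an open set.\<close>

lemma edim_le_pushout:
  assumes Z: "edim_le (topo Z) c"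
    and W: "edim_le (subtopology (topo W) (topspace (topo W) - i ` topspace (topo S))) c"
  shows "edim_le (topo P) c"
proof (rule edim_le_closed_open)
  let ?W = "topspace (topo W) - i ` topspace (topo S)"
  let ?P = "topspace (topo P) - p ` topspace (topo Z)"
  show "closedin (topo P) (p ` topspace (topo Z))"
    using closed_p by (simp add: closed_map_def)
  have "homeomorphic_map (topo Z) (subtopology (topo P) (p ` topspace (topo Z))) p"
    using injective_closed_imp_embedding_map[OF p closed_p inj_p] by (simp add: embedding_map_def)
  then obtain r where r: "homeomorphic_maps (topo Z) (subtopology (topo P) (p ` topspace (topo Z))) p r"
    by (auto simp: homeomorphic_map_maps)
  show "edim_le (subtopology (topo P) (p ` topspace (topo Z))) c"
  proof (rule edim_le_inj[OF Z])
    show "continuous_map (subtopology (topo P) (p ` topspace (topo Z))) (topo Z) r"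
      using r by (simp add: homeomorphic_maps_def)
    show "inj_on r (topspace (subtopology (topo P) (p ` topspace (topo Z))))"
      using r unfolding homeomorphic_maps_def by (metis inj_on_inverseI)
  qed
  define r' where "r' = inv_into ?W q"
  have r'q: "r' (q w) = w" if "w \<in> ?W" for w
    unfolding r'_def using inj_q that by (rule inv_into_f_f)
  have qr': "q (r' y) = y \<and> r' y \<in> ?W" if "y \<in> ?P" for y
    using cover[OF that] r'q by auto
  have iS: "closedin (topo W) (i ` topspace (topo S))"
    using closed_i by (simp add: closed_map_def)
  show "edim_le (subtopology (topo P) ?P) c"
  proof (rule edim_le_inj[OF W])
    show "inj_on r' (topspace (subtopology (topo P) ?P))"
      using qr' by (auto intro!: inj_onI) metis
    have top: "topspace (subtopology (topo P) ?P) = ?P" "topspace (subtopology (topo W) ?W) = ?W"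
      by auto
    \<comment> \<open>For the continuity of \<open>r'\<close>: a closed set \<open>K\<close> that
      contains the whole glued part becomes saturated when all of \<open>Z\<close> is added.\<close>
    have "closedin (topo P) (p ` topspace (topo Z) \<union> q ` K)"
      if K: "closedin (topo W) K" "i ` topspace (topo S) \<subseteq> K" for K
    proof -
      have KW: "K \<subseteq> topspace (topo W)" using K by (simp add: closedin_subset)
      let ?C = "p ` topspace (topo Z) \<union> q ` K"
      have "{z \<in> topspace (topo Z). p z \<in> ?C} = topspace (topo Z)" by auto
      moreover have "{w \<in> topspace (topo W). q w \<in> ?C} = K"
      proof -
        have "w \<in> K" if w: "w \<in> topspace (topo W)" "q w \<in> ?C" for w
        proof (rule ccontr)
          assume nK: "w \<notin> K"
          then have wW: "w \<in> ?W" using w K(2) by blast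
          then have "q w \<notin> p ` topspace (topo Z)" using p_neq_q by fastforce
          then obtain k where k: "k \<in> K" "q w = q k" using w(2) by blast
          show False
          proof (cases "k \<in> i ` topspace (topo S)")
            case True
            then have "q k \<in> p ` topspace (topo Z)"
              using g_in by (auto simp flip: commutes)
            then show False using k \<open>q w \<notin> p ` topspace (topo Z)\<close> by simp
          next
            case False
            then have "w = k" using inj_q wW k KW by (auto simp: inj_on_def)
            then show False using nK k by simp
          qed
        qed
        then show ?thesis using KW by blast
      qed
      ultimately show ?thesis
        using K(1) KW p_in q_in by (subst closedin_iff) auto
    qed
    note closed_union = this
    have "openin (subtopology (topo P) ?P) {y \<in> ?P. r' y \<in> T}"
      if "openin (subtopology (topo W) ?W) T" for T
    proof -
      have T: "openin (topo W) T" "T \<subseteq> ?W"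
        using that iS by (auto simp: openin_open_subtopology closedin_def)
      \<comment> \<open>\<open>T\<close> avoids the glued part, so its complement contains
        it.\<close>
      let ?K = "topspace (topo W) - T"
      let ?C = "p ` topspace (topo Z) \<union> q ` ?K"
      have "closedin (topo P) ?C"
        using T i_in by (intro closed_union) auto
      then have "openin (topo P) (topspace (topo P) - ?C)"
        by (simp add: closedin_def)
      moreover have "{y \<in> ?P. r' y \<in> T} = (topspace (topo P) - ?C) \<inter> ?P"
      proof -
        have "r' y \<in> T \<longleftrightarrow> y \<notin> q ` ?K" if y: "y \<in> ?P" for y
        proof
          assume rT: "r' y \<in> T"
          show "y \<notin> q ` ?K"
          proof
            assume "y \<in> q ` ?K"
            then obtain k where k: "k \<in> ?K" "y = q k" by blast
            then have "k \<notin> i ` topspace (topo S)"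
              using y g_in by (auto simp flip: commutes)
            then have "r' y = k" using k r'q by simp
            then show False using rT k by simp
          qed
        next
          assume "y \<notin> q ` ?K"
          then show "r' y \<in> T" using qr'[OF y] by force
        qed
        then show ?thesis by blast
      qed
      ultimately show ?thesis
        unfolding openin_subtopology by blast
    qed
    then show "continuous_map (subtopology (topo P) ?P) (subtopology (topo W) ?W) r'"
      unfolding continuous_map_def top using qr' by auto
  qed
qed

text \<open>This serves the case without cells, where \<open>W\<close> is an empty wedge: its only
  point is already glued.\<close>

lemma surj_p:
  assumes "topspace (topo W) \<subseteq> i ` topspace (topo S)"
  shows "p ` topspace (topo Z) = topspace (topo P)"
  using cover assms p_in by blast

end

section \<open>Attaching cells of type \<open>A\<close>\<close>

lemma closedin_wedge_pt:
  assumes "\<And>j. j \<in> J \<Longrightarrow> closedin (topo (X j)) {pt (X j)}"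
  shows "closedin (topo (wedge J X)) {pt (wedge J X)}"
  unfolding pt_wedge unfolding wedge_def
  by (rule closedin_collapse_pt) (rule closedin_wedge_points[OF assms])

lemma attaches_0_cells:
  assumes att: "attaches_cells A 0 J Z j X" and A: "has_punctured_edim A c"
  shows "inj_on j (topspace (topo Z))" "closed_map (topo Z) (topo X) j"
    "edim_le (topo Z) c \<Longrightarrow> edim_le (topo X) c" "J \<noteq> {} \<Longrightarrow> edim_ge (topo X) c"
    "J = {} \<Longrightarrow> j ` topspace (topo Z) = topspace (topo X)"
proof -
  let ?W = "wedge J (\<lambda>_. A)"
  obtain f where po: "is_pushout one_point (\<lambda>_. pt Z) (\<lambda>_. pt ?W) Z ?W X j f"
    using att by (auto simp: attaches_cells_def)
  have ptW: "closedin (topo ?W) {pt ?W}"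
    using A by (intro closedin_wedge_pt) (simp add: has_punctured_edim_def)
  interpret closed_pushout one_point "\<lambda>_. pt Z" "\<lambda>_. pt ?W" Z ?W X j f
  proof
    show "closed_map (topo one_point) (topo ?W) (\<lambda>_. pt ?W)"
      using ptW by (auto simp: closed_map_def image_constant_conv)
  qed (use po in \<open>auto simp: one_point_def\<close>)
  have W: "subtopology (topo ?W) (topspace (topo ?W) - (\<lambda>_. pt ?W) ` topspace (topo one_point)) =
      punctured ?W"
    by (simp add: punctured_def one_point_def)
  show "inj_on j (topspace (topo Z))" "closed_map (topo Z) (topo X) j"
    using inj_p closed_p by auto
  show "edim_le (topo X) c" if "edim_le (topo Z) c"
  proof (rule edim_le_pushout[OF that])
    have "edim_le (punctured ?W) c"
      by (rule edim_le_wedge) (use A in \<open>simp_all add: has_punctured_edim_def\<close>)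
    then show "edim_le (subtopology (topo ?W) (topspace (topo ?W) -
        (\<lambda>_. pt ?W) ` topspace (topo one_point))) c"
      by (simp only: W)
  qed
  show "edim_ge (topo X) c" if J: "J \<noteq> {}"
  proof (rule edim_ge_pushout)
    obtain k where k: "k \<in> J" using J by blast
    have "edim_ge (subtopology (topo ?W) (Some ` Pair k ` (topspace (topo A) - {pt A}))) c"
      using A k by (intro edim_ge_wedge) (auto simp: has_punctured_edim_def punctured_def)
    then show "edim_ge (subtopology (topo ?W) (topspace (topo ?W) -
        (\<lambda>_. pt ?W) ` topspace (topo one_point))) c"
      unfolding W punctured_def
      by (rule edim_ge_superset) (use k in \<open>auto simp: pt_wedge topspace_wedge\<close>)
  qed
  show "j ` topspace (topo Z) = topspace (topo X)" if "J = {}"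
    using that by (intro surj_p) (auto simp: topspace_wedge pt_wedge one_point_def)
qed

lemma pt_reduced_cone: "pt (reduced_cone X) = None"
  by (simp add: reduced_cone_def collapse_def)

lemma topspace_reduced_cone:
  "topspace (topo (reduced_cone X)) =
     insert None (Some ` ((topspace (topo X) - {pt X}) \<times> {0..<1}))"
proof -
  have "topspace (cylinder X) - cone_collapsed X = (topspace (topo X) - {pt X}) \<times> {0..<1}"
    by (auto simp: cone_collapsed_def)
  then show ?thesis
    by (simp add: reduced_cone_def topspace_collapse)
qed

lemma wedge_map_cone_base:
  "wedge_map J (\<lambda>_. reduced_cone S) (\<lambda>_. cone_base S) None = None"
  "j \<in> J \<Longrightarrow> s \<noteq> pt S \<Longrightarrow>
   wedge_map J (\<lambda>_. reduced_cone S) (\<lambda>_. cone_base S) (Some (j, s)) = Some (j, Some (s, 0))"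
  by (auto simp: wedge_map_def cone_base_def collapse_proj_def cone_collapsed_def pt_reduced_cone)

text \<open>Closedness is tested on each summand of the wedge and, for a cone, on the cylinder, so
  both quotients are undone before sets are compared. Only the base point needs care, being shared
  by all summands.\<close>

lemma closed_map_wedge_cone_base:
  assumes "closedin (topo S) {pt S}"
  shows "closed_map (topo (wedge J (\<lambda>_. S))) (topo (wedge J (\<lambda>_. reduced_cone S)))
    (wedge_map J (\<lambda>_. reduced_cone S) (\<lambda>_. cone_base S))" (is "closed_map ?S ?W ?i")
  unfolding closed_map_def
proof (intro allI impI)
  fix C assume C: "closedin ?S C"
  have CS: "C \<subseteq> insert None (Some ` (J \<times> (topspace (topo S) - {pt S})))"
    using closedin_subset[OF C] by (simp add: topspace_wedge)
  have CS': "j \<in> J" "s \<in> topspace (topo S)" "s \<noteq> pt S" if "Some (j, s) \<in> C" for j s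
    using subsetD[OF CS that] by auto
  define C' where "C' j = {s \<in> topspace (topo S). collapse_proj (wedge_points J (\<lambda>_. S)) (j, s) \<in> C}" for j
  have C': "closedin (topo S) (C' j)" if "j \<in> J" for j
    using C that unfolding closedin_wedge C'_def by blast
  have iC: "w \<in> ?i ` C \<longleftrightarrow> (w = None \<and> None \<in> C) \<or>
      (\<exists>j s. w = Some (j, Some (s, 0)) \<and> Some (j, s) \<in> C)" for w
  proof
    assume "w \<in> ?i ` C"
    then obtain u where u: "u \<in> C" "w = ?i u" by (rule imageE)
    show "(w = None \<and> None \<in> C) \<or> (\<exists>j s. w = Some (j, Some (s, 0)) \<and> Some (j, s) \<in> C)"
    proof (cases u)
      case None
      then show ?thesis using u wedge_map_cone_base(1)[of J S] by simp
    next
      case (Some v)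
      then obtain j s where js: "u = Some (j, s)"
        by (cases v) auto
      then show ?thesis using u wedge_map_cone_base(2)[of j J s S] CS'[of j s] by auto
    qed
  next
    assume "(w = None \<and> None \<in> C) \<or> (\<exists>j s. w = Some (j, Some (s, 0)) \<and> Some (j, s) \<in> C)"
    then show "w \<in> ?i ` C"
    proof
      assume "w = None \<and> None \<in> C"
      then show ?thesis using wedge_map_cone_base(1)[of J S] by (intro image_eqI[of _ _ None]) auto
    next
      assume "\<exists>j s. w = Some (j, Some (s, 0)) \<and> Some (j, s) \<in> C"
      then obtain j s where js: "w = Some (j, Some (s, 0))" "Some (j, s) \<in> C" by blast
      then have "j \<in> J" "s \<noteq> pt S" using CS' by blast+
      from wedge_map_cone_base(2)[OF this] show ?thesis
        using js by (intro image_eqI[of _ _ "Some (j, s)"]) auto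
    qed
  qed
  have sub: "?i ` C \<subseteq> topspace ?W"
  proof
    fix w assume "w \<in> ?i ` C"
    then consider "w = None" | j s where "w = Some (j, Some (s, 0))" "Some (j, s) \<in> C"
      unfolding iC by blast
    then show "w \<in> topspace ?W"
    proof cases
      case 2
      with CS'[OF 2(2)] show ?thesis
        by (auto simp: topspace_wedge topspace_reduced_cone pt_reduced_cone)
    qed (simp add: topspace_wedge)
  qed
  show "closedin ?W (?i ` C)"
    unfolding closedin_wedge
  proof (intro conjI ballI sub)
    fix j assume j: "j \<in> J"
    let ?D = "{y \<in> topspace (topo (reduced_cone S)).
               collapse_proj (wedge_points J (\<lambda>_. reduced_cone S)) (j, y) \<in> ?i ` C}"
    have D: "y \<in> ?D \<longleftrightarrow> (y = None \<and> None \<in> C) \<or> (\<exists>s. y = Some (s, 0) \<and> Some (j, s) \<in> C)" for y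
    proof (cases y)
      case None
      have "collapse_proj (wedge_points J (\<lambda>_. reduced_cone S)) (j, None) = None"
        using j by (auto simp: collapse_proj_def pt_reduced_cone)
      then show ?thesis
        unfolding None mem_Collect_eq iC by (simp add: topspace_reduced_cone)
    next
      case (Some x)
      have "collapse_proj (wedge_points J (\<lambda>_. reduced_cone S)) (j, Some x) = Some (j, Some x)"
        by (auto simp: collapse_proj_def pt_reduced_cone)
      then have D: "Some x \<in> ?D \<longleftrightarrow> Some x \<in> topspace (topo (reduced_cone S)) \<and>
          (\<exists>s. x = (s, 0) \<and> Some (j, s) \<in> C)"
        unfolding mem_Collect_eq iC by simp
      have "Some x \<in> topspace (topo (reduced_cone S))" if "x = (s, 0)" "Some (j, s) \<in> C" for s
        using CS'[OF that(2)] that(1) by (auto simp: topspace_reduced_cone)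
      then show ?thesis
        unfolding Some D by blast
    qed
    \<comment> \<open>In cylinder \<open>j\<close>, the image of \<open>C\<close> pulls back to the
      trace \<open>C' j\<close> at height 0, together with the whole collapsed set exactly when
      \<open>C\<close> contains the wedge point.\<close>
    have "{x \<in> topspace (cylinder S). collapse_proj (cone_collapsed S) x \<in> ?D} =
        C' j \<times> {0} \<union> (if None \<in> C then cone_collapsed S else {})"
      (is "?l = ?r")
    proof (rule Set.set_eqI)
      fix x :: "'a \<times> real"
      obtain s t where x: "x = (s, t)" by (cases x)
      have ptS: "pt S \<in> topspace (topo S)"
        using assms closedin_subset by blast
      have pj: "collapse_proj (wedge_points J (\<lambda>_. S)) (j, s) = (if s = pt S then None else Some (j, s))"
        using j by (auto simp: collapse_proj_def)
      have "x \<in> ?l \<longleftrightarrow> (s \<in> topspace (topo S) \<and> 0 \<le> t \<and> t \<le> 1 \<and>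
          (x \<in> cone_collapsed S \<and> None \<in> C \<or> x \<notin> cone_collapsed S \<and> t = 0 \<and> Some (j, s) \<in> C))"
        unfolding x by (subst mem_Collect_eq, subst D) (auto simp: collapse_proj_def)
      also have "\<dots> \<longleftrightarrow> x \<in> ?r"
        using ptS CS'[of j s] by (auto simp: x cone_collapsed_def C'_def pj)
      finally show "x \<in> ?l \<longleftrightarrow> x \<in> ?r" .
    qed
    moreover have "closedin (cylinder S) (C' j \<times> {0})"
      using C'[OF j] by (auto simp: closedin_prod_Times_iff closedin_closed_eq)
    ultimately have "closedin (cylinder S) {x \<in> topspace (cylinder S). collapse_proj (cone_collapsed S) x \<in> ?D}"
      using closedin_cone_collapsed[OF assms] by auto
    then show "closedin (topo (reduced_cone S)) ?D"
      unfolding reduced_cone_def closedin_collapse by auto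
  qed
qed

text \<open>\<open>m\<close> suspensions raise the bound from \<open>c\<close> to
  \<open>c + m\<close>, and the cone adds one more.\<close>

lemma attaches_Suc_cells:
  assumes att: "attaches_cells A (Suc m) J Z j X" and A: "has_punctured_edim A c"
  shows "inj_on j (topspace (topo Z))" "closed_map (topo Z) (topo X) j"
    "edim_le (topo Z) (c + Suc m) \<Longrightarrow> edim_le (topo X) (c + Suc m)"
    "J \<noteq> {} \<Longrightarrow> edim_ge (topo X) (c + Suc m)"
    "J = {} \<Longrightarrow> j ` topspace (topo Z) = topspace (topo X)"
proof -
  define S where "S = iter_suspension m A"
  let ?S = "wedge J (\<lambda>_. S)"
  let ?W = "wedge J (\<lambda>_. reduced_cone S)"
  let ?i = "wedge_map J (\<lambda>_. reduced_cone S) (\<lambda>_. cone_base S)"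
  have S: "has_punctured_edim S (c + m)"
    unfolding S_def by (rule has_punctured_edim_iter_suspension[OF A])
  then have ptS: "closedin (topo S) {pt S}" by (simp add: has_punctured_edim_def)
  obtain g f where po: "is_pushout ?S g ?i Z ?W X j f"
    using att by (auto simp: attaches_cells_def S_def Let_def)
  interpret closed_pushout ?S g ?i Z ?W X j f
  proof
    show "closed_map (topo ?S) (topo ?W) ?i"
      by (rule closed_map_wedge_cone_base[OF ptS])
    show "inj_on ?i (topspace (topo ?S))"
      by (auto simp: inj_on_def topspace_wedge wedge_map_cone_base)
  qed (use po in auto)
  show "inj_on j (topspace (topo Z))" "closed_map (topo Z) (topo X) j"
    using inj_p closed_p by auto
  \<comment> \<open>The glued part lies at height 0 or is the wedge point; hence the open cylinders
    used for the lower bound avoid it.\<close>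
  have i_image: "?i ` topspace (topo ?S) =
      insert None ((\<lambda>(j, s). Some (j, Some (s, 0))) ` (J \<times> (topspace (topo S) - {pt S})))"
  proof -
    have "?i ` Some ` (J \<times> (topspace (topo S) - {pt S})) =
        (\<lambda>(j, s). Some (j, Some (s, 0))) ` (J \<times> (topspace (topo S) - {pt S}))"
      unfolding image_image
    proof (rule image_cong[OF refl])
      fix x assume "x \<in> J \<times> (topspace (topo S) - {pt S})"
      then obtain k s where x: "x = (k, s)" "k \<in> J" "s \<noteq> pt S" by blast
      show "?i (Some x) = (\<lambda>(j, s). Some (j, Some (s, 0))) x"
        using wedge_map_cone_base(2)[OF x(2,3)] x(1) by simp
    qed
    then show ?thesis
      by (simp add: topspace_wedge wedge_map_cone_base)
  qed
  have None_base: "None \<in> ?i ` topspace (topo ?S)"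
    by (simp add: i_image)
  have cone: "closedin (cylinder S) (cone_collapsed S)"
    by (rule closedin_cone_collapsed[OF ptS])
  have "{pt S} \<times> {0..1} \<subseteq> cone_collapsed S"
      "cone_collapsed S \<subseteq> topspace (topo S) \<times> {0, 1} \<union> {pt S} \<times> {0..1}"
    by (auto simp: cone_collapsed_def)
  note e = cylinder_quotient_edim[OF S cone this]
  show "edim_le (topo X) (c + Suc m)" if "edim_le (topo Z) (c + Suc m)"
  proof (rule edim_le_pushout[OF that])
    have "edim_le (punctured ?W) (Suc (c + m))"
    proof (rule edim_le_wedge)
      show "closedin (topo (reduced_cone S)) {pt (reduced_cone S)}"
        unfolding pt_reduced_cone unfolding reduced_cone_def by (rule closedin_collapse_pt[OF cone])
      show "edim_le (punctured (reduced_cone S)) (Suc (c + m))"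
        unfolding punctured_def pt_reduced_cone unfolding reduced_cone_def by (rule e(1))
    qed
    \<comment> \<open>The wedge point is glued, so what remains lies in the punctured wedge.\<close>
    then show "edim_le (subtopology (topo ?W) (topspace (topo ?W) - ?i ` topspace (topo ?S))) (c + Suc m)"
      unfolding punctured_def pt_wedge add_Suc_right
      by (rule edim_le_subset) (use None_base in auto)
  qed
  show "edim_ge (topo X) (c + Suc m)" if J: "J \<noteq> {}"
  proof (rule edim_ge_pushout)
    obtain k where k: "k \<in> J" using J by blast
    let ?R = "Some ` ((topspace (topo S) - {pt S}) \<times> {0<..<1::real})"
    have R: "?R \<subseteq> topspace (topo (reduced_cone S)) - {pt (reduced_cone S)}"
      by (auto simp: topspace_reduced_cone pt_reduced_cone)
    have "edim_ge (subtopology (topo ?W) (Some ` Pair k ` ?R)) (Suc (c + m))"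
      using k R e(2) by (intro edim_ge_wedge) (auto simp: reduced_cone_def)
    moreover have "Some ` Pair k ` ?R \<subseteq> topspace (topo ?W) - ?i ` topspace (topo ?S)"
      using k R unfolding i_image by (auto simp: topspace_wedge)
    ultimately show "edim_ge (subtopology (topo ?W) (topspace (topo ?W) - ?i ` topspace (topo ?S))) (c + Suc m)"
      unfolding add_Suc_right by (rule edim_ge_superset)
  qed
  show "j ` topspace (topo Z) = topspace (topo X)" if "J = {}"
    using that None_base by (intro surj_p) (auto simp: topspace_wedge)
qed

lemma attaches_cells_edim:
  assumes att: "attaches_cells A n J Z j X" and A: "has_punctured_edim A c"
  shows attaches_cells_inj: "inj_on j (topspace (topo Z))"
    and attaches_cells_closed: "closed_map (topo Z) (topo X) j"
    and attaches_cells_edim_le: "edim_le (topo Z) (c + n) \<Longrightarrow> edim_le (topo X) (c + n)"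
    and attaches_cells_edim_ge: "J \<noteq> {} \<Longrightarrow> edim_ge (topo X) (c + n)"
    and attaches_no_cells: "J = {} \<Longrightarrow> j ` topspace (topo Z) = topspace (topo X)"
proof -
  have "inj_on j (topspace (topo Z)) \<and>
    closed_map (topo Z) (topo X) j \<and>
    (edim_le (topo Z) (c + n) \<longrightarrow> edim_le (topo X) (c + n)) \<and>
    (J \<noteq> {} \<longrightarrow> edim_ge (topo X) (c + n)) \<and>
    (J = {} \<longrightarrow> j ` topspace (topo Z) = topspace (topo X))"
  proof (cases n)
    case 0
    show ?thesis
      using attaches_0_cells[OF att[unfolded 0] A] unfolding 0 add_0_right by blast
  next
    case (Suc m)
    show ?thesis
      using attaches_Suc_cells[OF att[unfolded Suc] A] unfolding Suc by blast
  qed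
  then show "inj_on j (topspace (topo Z))" "closed_map (topo Z) (topo X) j" "edim_le (topo Z) (c + n) \<Longrightarrow> edim_le (topo X) (c + n)"
    "J \<noteq> {} \<Longrightarrow> edim_ge (topo X) (c + n)"
    "J = {} \<Longrightarrow> j ` topspace (topo Z) = topspace (topo X)"
    by blast+
qed


section \<open>Sequential colimits along closed embeddings\<close>

locale closed_sequence =
  fixes X :: "nat \<Rightarrow> 'k pointed" and b and L :: "'x pointed" and c
  assumes colimit: "is_sequential_colimit X b L c"
    and inj_b: "inj_on (b k) (topspace (topo (X k)))"
    and closed_b: "closed_map (topo (X k)) (topo (X (Suc k))) (b k)"
begin

abbreviation "related u v \<equiv> \<exists>k. \<exists>x\<in>topspace (topo (X k)). u = (k, x) \<and> v = (Suc k, b k x)"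

lemma b: "continuous_map (topo (X k)) (topo (X (Suc k))) (b k)"
  and c: "continuous_map (topo (X k)) (topo L) (c k)"
  and quotient: "quotient_map (sum_topology (\<lambda>k. topo (X k)) UNIV) (topo L) (\<lambda>(k, x). c k x)"
  using colimit by (simp_all add: is_sequential_colimit_def pointed_map_def is_quotient_by_def)

lemma fibres:
  assumes "x \<in> topspace (topo (X k))" "y \<in> topspace (topo (X l))"
  shows "c k x = c l y \<longleftrightarrow> equivclp related (k, x) (l, y)"
proof -
  have "\<forall>u\<in>topspace (sum_topology (\<lambda>k. topo (X k)) UNIV). \<forall>v\<in>topspace (sum_topology (\<lambda>k. topo (X k)) UNIV).
      (\<lambda>(k, x). c k x) u = (\<lambda>(k, x). c k x) v \<longleftrightarrow> equivclp related u v"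
    using colimit by (simp add: is_sequential_colimit_def is_quotient_by_def)
  from this[rule_format, of "(k, x)" "(l, y)"] show ?thesis using assms by simp
qed

lemma b_in: "x \<in> topspace (topo (X k)) \<Longrightarrow> b k x \<in> topspace (topo (X (Suc k)))"
  and c_in: "x \<in> topspace (topo (X k)) \<Longrightarrow> c k x \<in> topspace (topo L)"
  using continuous_map_funspace[OF b] continuous_map_funspace[OF c] by blast+

lemma c_b:
  assumes "x \<in> topspace (topo (X k))"
  shows "c (Suc k) (b k x) = c k x"
proof -
  have "equivclp related (k, x) (Suc k, b k x)"
    by (rule r_into_equivclp) (use assms in blast)
  then show ?thesis
    using fibres[OF assms b_in[OF assms]] by simp
qed

primrec iter :: "nat \<Rightarrow> nat \<Rightarrow> 'k \<Rightarrow> 'k" where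
  "iter k 0 x = x"
| "iter k (Suc n) x = b (k + n) (iter k n x)"

text \<open>Meaningful for \<open>k \<le> N\<close> only.\<close>

definition push :: "nat \<Rightarrow> nat \<Rightarrow> 'k \<Rightarrow> 'k" where
  "push N k = iter k (N - k)"

lemma push_same [simp]: "push k k x = x"
  by (simp add: push_def)

lemma push_Suc: "k \<le> N \<Longrightarrow> push (Suc N) k x = b N (push N k x)"
  by (simp add: push_def Suc_diff_le)

lemma push_in: "k \<le> N \<Longrightarrow> x \<in> topspace (topo (X k)) \<Longrightarrow> push N k x \<in> topspace (topo (X N))"
  by (induction N rule: dec_induct) (auto simp: push_Suc b_in)

lemma push_mono:
  assumes "N \<le> N'" "k \<le> N" "l \<le> N" "push N k x = push N l y"
  shows "push N' k x = push N' l y"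
  using assms(1) by (induction N' rule: dec_induct) (use assms in \<open>auto simp: push_Suc\<close>)

lemma c_push: "k \<le> N \<Longrightarrow> x \<in> topspace (topo (X k)) \<Longrightarrow> c N (push N k x) = c k x"
  by (induction N rule: dec_induct) (auto simp: push_Suc c_b push_in)

lemma continuous_push: "k \<le> N \<Longrightarrow> continuous_map (topo (X k)) (topo (X N)) (push N k)"
proof (induction N rule: dec_induct)
  case base
  have "push k k = id" by (simp add: fun_eq_iff)
  then show ?case by simp
next
  case (step N)
  have "push (Suc N) k = b N \<circ> push N k"
    using step(1) by (simp add: fun_eq_iff push_Suc)
  then show ?case using continuous_map_compose[OF step.IH b] by (simp only:)
qed

lemma inj_push: "k \<le> N \<Longrightarrow> inj_on (push N k) (topspace (topo (X k)))"
proof (induction N rule: dec_induct)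
  case (step N)
  then show ?case
    using inj_b[of N] push_in unfolding inj_on_def by (metis push_Suc)
qed (simp add: inj_on_def)

lemma closed_push:
  assumes "closedin (topo (X k)) C" "k \<le> N"
  shows "closedin (topo (X N)) (push N k ` C)"
  using assms(2)
proof (induction N rule: dec_induct)
  case (step N)
  have "push (Suc N) k ` C = b N ` push N k ` C"
    using step(1) by (auto simp: push_Suc image_image)
  then show ?case using step.IH closed_b by (simp add: closed_map_def)
qed (use assms(1) in simp)

text \<open>The generated equivalence is eventual equality: a zigzag through neighbouring stages is
  straightened by pushing everything to one late stage.\<close>

lemma equivclp_push:
  assumes "equivclp related u v"
  shows "\<exists>N. fst u \<le> N \<and> fst v \<le> N \<and> push N (fst u) (snd u) = push N (fst v) (snd v)"
  using assms
proof (induction rule: equivclp_induct)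
  case base
  then show ?case by auto
next
  case (step y z)
  then obtain N where N: "fst u \<le> N" "fst y \<le> N" "push N (fst u) (snd u) = push N (fst y) (snd y)"
    by blast
  obtain M where M: "fst y \<le> M" "fst z \<le> M" "push M (fst y) (snd y) = push M (fst z) (snd z)"
  proof -
    have "\<exists>M. fst u \<le> M \<and> fst v \<le> M \<and> push M (fst u) (snd u) = push M (fst v) (snd v)"
      if "related u v" for u v
      using that by (auto simp: push_Suc intro!: exI[of _ "fst v"])
    then show thesis using step.hyps(2) that by metis
  qed
  let ?K = "max N M"
  have "push ?K (fst u) (snd u) = push ?K (fst y) (snd y)"
    by (rule push_mono[OF _ N]) simp
  moreover have "push ?K (fst y) (snd y) = push ?K (fst z) (snd z)"
    by (rule push_mono[OF _ M]) simp
  ultimately show ?case using N M by (intro exI[of _ ?K]) auto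
qed

lemma inj_c: "inj_on (c k) (topspace (topo (X k)))"
proof (rule inj_onI)
  fix x y assume xy: "x \<in> topspace (topo (X k))" "y \<in> topspace (topo (X k))" "c k x = c k y"
  then obtain N where "k \<le> N" "push N k x = push N k y"
    using equivclp_push[of "(k, x)" "(k, y)"] fibres by auto
  then show "x = y"
    using inj_push xy by (auto simp: inj_on_def)
qed

lemma cover:
  assumes "y \<in> topspace (topo L)"
  obtains k x where "x \<in> topspace (topo (X k))" "y = c k x"
  using assms quotient_imp_surjective_map[OF quotient] by force

text \<open>The colimit topology is tested on the stages. At a later stage the image of
  \<open>C\<close> pulls back to a pushed copy of \<open>C\<close>, closed because the bonds are
  closed maps; at an earlier stage, to a preimage of \<open>C\<close> under a continuous
  map.\<close>

lemma closed_c: "closed_map (topo (X k)) (topo L) (c k)"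
  unfolding closed_map_def
proof (intro allI impI)
  fix C assume C: "closedin (topo (X k)) C"
  then have CX: "C \<subseteq> topspace (topo (X k))" by (rule closedin_subset)
  have "closedin (topo (X l)) {y \<in> topspace (topo (X l)). c l y \<in> c k ` C}" for l
  proof (cases "k \<le> l")
    case True
    have "{y \<in> topspace (topo (X l)). c l y \<in> c k ` C} = push l k ` C"
    proof
      show "{y \<in> topspace (topo (X l)). c l y \<in> c k ` C} \<subseteq> push l k ` C"
      proof
        fix y assume "y \<in> {y \<in> topspace (topo (X l)). c l y \<in> c k ` C}"
        then obtain x where x: "y \<in> topspace (topo (X l))" "x \<in> C" "c l y = c k x" by auto
        then have "c l y = c l (push l k x)"
          using c_push[OF True] CX by auto
        then have "y = push l k x"
          using inj_c[of l] x push_in[OF True] CX by (auto simp: inj_on_def)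
        then show "y \<in> push l k ` C" using x by blast
      qed
      show "push l k ` C \<subseteq> {y \<in> topspace (topo (X l)). c l y \<in> c k ` C}"
        using CX push_in[OF True] c_push[OF True] by auto
    qed
    then show ?thesis using closed_push[OF C True] by simp
  next
    case False
    then have lk: "l \<le> k" by simp
    have "{y \<in> topspace (topo (X l)). c l y \<in> c k ` C} =
          {y \<in> topspace (topo (X l)). push k l y \<in> C}"
    proof -
      have "c l y \<in> c k ` C \<longleftrightarrow> push k l y \<in> C" if y: "y \<in> topspace (topo (X l))" for y
        using c_push[OF lk y] inj_c[of k] push_in[OF lk y] CX
        by (metis image_eqI inj_on_image_mem_iff)
      then show ?thesis by blast
    qed
    then show ?thesis
      using closedin_continuous_map_preimage[OF continuous_push[OF lk] C] by simp
  qed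
  then have "closedin (sum_topology (\<lambda>k. topo (X k)) UNIV)
      {u \<in> topspace (sum_topology (\<lambda>k. topo (X k)) UNIV). (\<lambda>(k, x). c k x) u \<in> c k ` C}"
    unfolding closedin_sum_topology by auto
  moreover have "c k ` C \<subseteq> topspace (topo L)"
    using CX c_in by blast
  ultimately show "closedin (topo L) (c k ` C)"
    using quotient unfolding quotient_map_closedin by blast
qed

text \<open>Every \<open>c k\<close> is already a closed embedding, so whether a stage is the whole
  space is a question about points only.\<close>

lemma homeomorphic_c_iff:
  "homeomorphic_map (topo (X k)) (topo L) (c k) \<longleftrightarrow> c k ` topspace (topo (X k)) = topspace (topo L)"
proof
  show "c k ` topspace (topo (X k)) = topspace (topo L)"
    if "homeomorphic_map (topo (X k)) (topo L) (c k)"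
    using that by (rule homeomorphic_imp_surjective_map)
  show "homeomorphic_map (topo (X k)) (topo L) (c k)"
    if "c k ` topspace (topo (X k)) = topspace (topo L)"
    using c closed_c that inj_c by (rule bijective_closed_imp_homeomorphic_map)
qed

end


section \<open>The dimension of a generalized CW-structure\<close>

text \<open>\<open>c\<close> depends on \<open>A\<close> alone, so two structures on
  \<open>X\<close> can be compared through the same number.\<close>

locale CWA =
  fixes A :: "'a pointed" and X :: "'x pointed" and K :: "('j, 'k, 'x) CWA_structure" and c :: nat
  assumes K: "is_CWA_structure A X K" and A: "has_punctured_edim A c"
begin

lemma attaches: "attaches_cells A n (cells K n) (stage K n) (bond K n) (stage K (Suc n))"
  and pointed_stage: "pt (stage K n) \<in> topspace (topo (stage K n))"
  and stage_0: "topspace (topo (stage K 0)) = {pt (stage K 0)}"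
  using K by (auto simp: is_CWA_structure_def pointed_space_def)

sublocale closed_sequence "stage K" "bond K" X "incl K"
proof
  show "is_sequential_colimit (stage K) (bond K) X (incl K)"
    using K by (simp add: is_CWA_structure_def)
  show "inj_on (bond K k) (topspace (topo (stage K k)))" for k
    by (rule attaches_cells_inj[OF attaches A])
  show "closed_map (topo (stage K k)) (topo (stage K (Suc k))) (bond K k)" for k
    by (rule attaches_cells_closed[OF attaches A])
qed

lemma stage_is_all_iff:
  "stage_is_all X K n \<longleftrightarrow> incl K n ` topspace (topo (stage K n)) = topspace (topo X)"
  by (simp add: stage_is_all_def homeomorphic_c_iff)

text \<open>The stage with index \<open>n\<close> is X^(n-1), whence the shift. Truncated
  subtraction lets the formula cover the initial point, whose bound 0 is weakened to
  \<open>c\<close>.\<close>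

lemma edim_le_stage: "edim_le (topo (stage K n)) (c + (n - 1))"
proof (induction n)
  case 0
  have "topo (stage K 0) = subtopology (topo (stage K 0)) {pt (stage K 0)}"
    by (metis stage_0 subtopology_topspace)
  then show ?case
    by (metis edim_le_mono edim_le_singleton le0)
next
  case (Suc n)
  then have "edim_le (topo (stage K n)) (c + n)"
    by (rule edim_le_mono) simp
  then show ?case
    using attaches_cells_edim_le[OF attaches A] by simp
qed

lemma edim_le_if_stage_is_all:
  assumes "stage_is_all X K (Suc n)"
  shows "edim_le (topo X) (c + n)"
proof -
  obtain g where "homeomorphic_maps (topo (stage K (Suc n))) (topo X) (incl K (Suc n)) g"
    using assms by (auto simp: stage_is_all_def homeomorphic_map_maps)
  then have "continuous_map (topo X) (topo (stage K (Suc n))) g" "inj_on g (topspace (topo X))"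
    unfolding homeomorphic_maps_def by (simp_all add: inj_on_def) metis
  then show ?thesis
    using edim_le_inj edim_le_stage[of "Suc n"] by fastforce
qed

text \<open>The stage that has just received the \<open>n\<close>-cells injects into the colimit, so
  its plots survive.\<close>

lemma edim_ge_if_cells:
  assumes "cells K n \<noteq> {}"
  shows "edim_ge (topo X) (c + n)"
  by (rule edim_ge_inj[OF attaches_cells_edim_ge[OF attaches A assms] c inj_c])

lemma incl_image_Suc:
  assumes "cells K n = {}"
  shows "incl K (Suc n) ` topspace (topo (stage K (Suc n))) = incl K n ` topspace (topo (stage K n))"
  unfolding attaches_no_cells[OF attaches A assms, symmetric] image_image
  by (rule image_cong) (auto simp: c_b)

text \<open>Without \<open>n\<close>-cells, the stages before and after have the same image in
  \<open>X\<close>, so both or neither would be all of it.\<close>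

lemma cells_nonempty:
  assumes "has_finite_dimension X K n"
  shows "cells K n \<noteq> {}"
  using assms incl_image_Suc[of n] unfolding has_finite_dimension_def stage_is_all_iff by auto

lemma stage_is_all_if_no_cells:
  assumes "\<And>k. k \<ge> M \<Longrightarrow> cells K k = {}"
  shows "stage_is_all X K M"
  unfolding stage_is_all_iff
proof
  have le: "incl K N ` topspace (topo (stage K N)) = incl K M ` topspace (topo (stage K M))"
    if "M \<le> N" for N
    using that by (induction N rule: dec_induct) (simp_all add: incl_image_Suc assms)
  show "topspace (topo X) \<subseteq> incl K M ` topspace (topo (stage K M))"
  proof
    fix y assume "y \<in> topspace (topo X)"
    then obtain k x where kx: "x \<in> topspace (topo (stage K k))" "y = incl K k x"
      by (rule cover)
    let ?N = "max k M"
    have "y = incl K ?N (push ?N k x)" "push ?N k x \<in> topspace (topo (stage K ?N))"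
      using kx c_push[of k ?N x] push_in[of k ?N x] by auto
    then have "y \<in> incl K ?N ` topspace (topo (stage K ?N))" by blast
    then show "y \<in> incl K M ` topspace (topo (stage K M))"
      using le[of ?N] by simp
  qed
qed (use c_in in blast)

text \<open>The one-point space has to be set apart: a structure without any cells has no finite
  dimension either.\<close>

lemma infinite_dimension:
  assumes "\<nexists>n. has_finite_dimension X K n" "topspace (topo X) \<noteq> {pt X}"
  shows "\<exists>k\<ge>M. cells K k \<noteq> {}"
proof (rule ccontr)
  assume "\<not> (\<exists>k\<ge>M. cells K k \<noteq> {})"
  then have M: "stage_is_all X K M"
    by (intro stage_is_all_if_no_cells) blast
  \<comment> \<open>Absence of a finite dimension means that being all of \<open>X\<close> descends
    from each stage to the previous one, down to X^(-1), which is a point.\<close>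
  have "stage_is_all X K 0"
    using M by (induction M) (use assms(1) in \<open>auto simp: has_finite_dimension_def\<close>)
  then have "topspace (topo X) = {incl K 0 (pt (stage K 0))}"
    unfolding stage_is_all_iff stage_0 by simp
  moreover have "pt X \<in> topspace (topo X)"
    using K by (simp add: is_CWA_structure_def pointed_space_def)
  ultimately show False using assms(2) by simp
qed

text \<open>Every stage has a base point and so maps onto a one-point space; all structures on such
  a space have dimension \<infinity>.\<close>

lemma not_point:
  assumes "has_finite_dimension X K n"
  shows "topspace (topo X) \<noteq> {pt X}"
proof
  assume X: "topspace (topo X) = {pt X}"
  have "incl K n x = pt X" if "x \<in> topspace (topo (stage K n))" for x
    using c_in[OF that] X by blast
  then have "incl K n ` topspace (topo (stage K n)) = {pt X}"
    using pointed_stage[of n] by force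
  then have "stage_is_all X K n"
    unfolding stage_is_all_iff X .
  then show False using assms by (simp add: has_finite_dimension_def)
qed

end

text \<open>One dimension is taken finite: two infinite ones agree anyway, and the roles of the
  structures can be exchanged.\<close>

lemma dimension_unique:
  fixes K :: "('j, 'k, 'x) CWA_structure" and K' :: "('j', 'k', 'x) CWA_structure"
  assumes "CWA A X K c" "CWA A X K' c" "has_finite_dimension X K n" "has_dimension X K' m"
  shows "m = enat n"
proof -
  interpret K: CWA A X K c by fact
  interpret K': CWA A X K' c by fact
  have le: "edim_le (topo X) (c + n)"
    using assms(3) by (intro K.edim_le_if_stage_is_all) (simp add: has_finite_dimension_def)
  show ?thesis
  proof (cases m)
    case (enat m')
    then have m': "has_finite_dimension X K' m'"
      using assms(4) by (simp add: has_dimension_def)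
    then have "edim_le (topo X) (c + m')"
      by (intro K'.edim_le_if_stage_is_all) (simp add: has_finite_dimension_def)
    \<comment> \<open>The top cells of each structure give a lower bound that the other structure's
      upper bound must respect.\<close>
    then have "c + n \<le> c + m'" "c + m' \<le> c + n"
      using le edim_ge_imp_le K.edim_ge_if_cells K.cells_nonempty[OF assms(3)]
        K'.edim_ge_if_cells K'.cells_nonempty[OF m'] by blast+
    then show ?thesis using enat by simp
  next
    case infinity
    then have "\<nexists>k. has_finite_dimension X K' k"
      using assms(4) by (simp add: has_dimension_def)
    \<comment> \<open>A cell of the second structure above dimension \<open>n\<close> contradicts
      the upper bound from the first.\<close>
    then obtain k where "k \<ge> Suc n" "cells K' k \<noteq> {}"
      using K'.infinite_dimension K.not_point[OF assms(3)] by blast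
    then have "c + k \<le> c + n"
      using le edim_ge_imp_le K'.edim_ge_if_cells by blast
    then show ?thesis using \<open>k \<ge> Suc n\<close> by simp
  qed
qed

theorem proposition2p11:
  fixes A :: "'a pointed"
    and X :: "'x pointed"
    and K :: "('j, 'k, 'x) CWA_structure"
    and K' :: "('j', 'k', 'x) CWA_structure"
    and n m :: enat
  assumes "pointed_space A"
    and "finite_dimensional_CW_complex (topo A)"
    and "topspace (topo A) \<noteq> {pt A}"
    and "is_CWA_structure A X K"
    and "is_CWA_structure A X K'"
    and "has_dimension X K n"
    and "has_dimension X K' m"
  shows "n = m"
proof -
  have "pt A \<in> topspace (topo A)"
    using assms(1) by (simp add: pointed_space_def)
  then obtain c where c: "Hausdorff_space (topo A)" "edim_le (topo A) c" "edim_ge (punctured A) c"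
    using finite_dimensional_CW_complex_edim[OF assms(2) _ assms(3)] by (metis punctured_def)
  have "edim_le (punctured A) c"
    unfolding punctured_def using c(2) edim_le_subset[of "topo A" "topspace (topo A)"]
    by (simp add: Diff_subset)
  \<comment> \<open>The Hausdorff property of \<open>A\<close> enters as closedness of its base
    point.\<close>
  then have "has_punctured_edim A c"
    using c \<open>pt A \<in> topspace (topo A)\<close> closedin_Hausdorff_singleton
    by (auto simp: has_punctured_edim_def)
  then have K: "CWA A X K c" "CWA A X K' c"
    using assms(4,5) by (simp_all add: CWA_def)
  show ?thesis
  proof (cases n)
    case (enat n')
    then show ?thesis
      using dimension_unique[OF K _ assms(7)] assms(6) by (simp add: has_dimension_def)
  next
    case infinity
    show ?thesis
    proof (cases m)
      case (enat m')
      then show ?thesis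
        using dimension_unique[OF K(2,1) _ assms(6)] assms(7) by (simp add: has_dimension_def)
    qed (use infinity in simp)
  qed
qed

end
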